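(* Let $p$ be an odd prime and let $G$ be a finite powerful $p$-group. Then the $(n+1)$-fold tensor product $G^{\otimes^p_{n+1}}$ and the iterated tensor product $G_{\otimes^p_{n+1}}$ are finite powerful $p$-groups for all $n\ge 1$.
   Context: For $p$ odd, a finite $p$-group $P$ is powerful if $[P,P]\leqslant P^p$ (the subgroup generated by $p$th powers). A crossed module is a homomorphism $\mu:M\to G$ with an action of $G$ on $M$ by automorphisms such that $\mu({}^gm)=g\mu(m)g^{-1}$ and ${}^{\mu(m)}m'=mm'm^{-1}$. Given crossed modules $\mu:M\to G$, $\nu:N\to G$, the groups $M,N$ act on $M$ and $N$ via $G$. Let $K=M\times_GN=\{(m,n):\mu(m)=\nu(n)\}$ with projections $\pi_1,\pi_2$; $K$ acts via its image in $G$. For a positive integer $q$, the tensor product modulo $q$, $M\otimes^qN$, is the group generated by symbols $m\otimes n$ and $\{k\}$ ($m\in M,n\in N,k\in K$) with relations (1) $m\otimes nn'=(m\otimes n)({}^nm\otimes{}^nn')$, (2) $mm'\otimes n=({}^mm'\otimes{}^mn)(m\otimes n)$, (3) $\{k\}(m\otimes n)\{k\}^{-1}={}^{k^q}m\otimes{}^{k^q}n$, (4) $\{kk'\}=\{k\}\prod_{i=1}^{q-1}\big(\pi_1k^{-1}\otimes({}^{k^{1-q+i}}\pi_2k')^i\big)\{k'\}$, (5) $[\{k\},\{k'\}]=\pi_1k^q\otimes\pi_2k'^q$, (6) $\{(m\,{}^nm^{-1},{}^mn\,n^{-1})\}=(m\otimes n)^q$, with $[a,b]=aba^{-1}b^{-1}$.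 $G$ acts on $M\otimes^qN$ by ${}^g(m\otimes n)={}^gm\otimes{}^gn$, ${}^g\{k\}=\{{}^gk\}$. There is a crossed module $\beta:M\otimes^qN\to N$ with $\beta(m\otimes n)={}^mn\,n^{-1}$, $\beta(\{k\})=\pi_2(k)^q$. $n$-fold: $G^{\otimes^q_1}=G$, $\mu_1=\mathrm{id}_G$; inductively, with respect to the crossed modules $\mu_{n}:G^{\otimes^q_{n}}\to G$ and $\mathrm{id}:G\to G$, $G^{\otimes^q_{n+1}}=G^{\otimes^q_{n}}\otimes^qG$ and $\mu_{n+1}=\beta:G^{\otimes^q_{n+1}}\to G$, again a crossed module. Iterated: $G_{\otimes^q_1}=G$ and $G_{\otimes^q_{n+1}}=G_{\otimes^q_n}\otimes^qG_{\otimes^q_n}$, formed with respect to the identity crossed modules $\mathrm{id}:G_{\otimes^q_n}\to G_{\otimes^q_n}$ (conjugation action). *)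

theory Defs
  imports "HOL-Computational_Algebra.Primes" "HOL-Algebra.Generated_Groups" "HOL-Algebra.Weak_Morphisms"
begin

section \<open>Finite powerful p-groups\<close>

definition finite_p_group :: "nat \<Rightarrow> ('a, 'b) monoid_scheme \<Rightarrow> bool" where
  "finite_p_group p P \<longleftrightarrow> group P \<and> finite (carrier P) \<and> (\<exists>a. order P = p ^ a)"

text \<open>This is the notion for odd \<open>p\<close>; for \<open>p = 2\<close> powerful means something else.\<close>

definition powerful_p_group :: "nat \<Rightarrow> ('a, 'b) monoid_scheme \<Rightarrow> bool" where
  "powerful_p_group p P \<longleftrightarrow>
     finite_p_group p P \<and>
     derived P (carrier P) \<subseteq> generate P {x [^]\<^bsub>P\<^esub> p | x. x \<in> carrier P}"


section \<open>Groups given by generators and relations\<close>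

text \<open>The letter \<open>(True, x)\<close> is the generator \<open>x\<close>, and \<open>(False, x)\<close> is its formal inverse.\<close>

type_synonym 'x word = "(bool \<times> 'x) list"

definition words :: "'x set \<Rightarrow> 'x word set" where
  "words X = lists (UNIV \<times> X)"

abbreviation letter :: "'x \<Rightarrow> 'x word" where
  "letter x \<equiv> [(True, x)]"

definition inv_word :: "'x word \<Rightarrow> 'x word" where
  "inv_word w = rev (map (\<lambda>(b, x). (\<not> b, x)) w)"

inductive_set word_cong :: "'x set \<Rightarrow> ('x word \<times> 'x word) set \<Rightarrow> ('x word \<times> 'x word) set"
  for X :: "'x set" and R :: "('x word \<times> 'x word) set" where
  refl: "(u, u) \<in> word_cong X R"
| sym: "(u, v) \<in> word_cong X R \<Longrightarrow> (v, u) \<in> word_cong X R"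
| trans: "(u, v) \<in> word_cong X R \<Longrightarrow> (v, w) \<in> word_cong X R \<Longrightarrow> (u, w) \<in> word_cong X R"
| append: "(u, u') \<in> word_cong X R \<Longrightarrow> (v, v') \<in> word_cong X R \<Longrightarrow>
     (u @ v, u' @ v') \<in> word_cong X R"
| cancel: "x \<in> X \<Longrightarrow> ([(b, x), (\<not> b, x)], []) \<in> word_cong X R"
| rel: "(u, v) \<in> R \<Longrightarrow> (u, v) \<in> word_cong X R"

definition presented_group :: "'x set \<Rightarrow> ('x word \<times> 'x word) set \<Rightarrow> 'x word set monoid" where
  "presented_group X R =
     \<lparr>carrier = words X // word_cong X R,
      monoid.mult = (\<lambda>A B. \<Union>u\<in>A. \<Union>v\<in>B. word_cong X R `` {u @ v}),
      one = word_cong X R `` {[]}\<rparr>"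

lemma equiv_word_cong: "equiv UNIV (word_cong X R)"
  by (rule equivI) (auto intro: refl_onI symI transI word_cong.intros)

lemma presented_group_mult:
  "(word_cong X R `` {u}) \<otimes>\<^bsub>presented_group X R\<^esub> (word_cong X R `` {v}) =
   word_cong X R `` {u @ v}"
proof -
  have "word_cong X R `` {u' @ v'} = word_cong X R `` {u @ v}"
    if "(u, u') \<in> word_cong X R" "(v, v') \<in> word_cong X R" for u' v'
    using equiv_class_eq[OF equiv_word_cong word_cong.append[OF that]] by simp
  then have "(\<Union>u'\<in>word_cong X R `` {u}. \<Union>v'\<in>word_cong X R `` {v}. word_cong X R `` {u' @ v'}) =
    (\<Union>u'\<in>word_cong X R `` {u}. \<Union>v'\<in>word_cong X R `` {v}. word_cong X R `` {u @ v})"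
    by (intro SUP_cong refl) auto
  also have "\<dots> = word_cong X R `` {u @ v}"
    using word_cong.refl[of u X R] word_cong.refl[of v X R] by blast
  finally show ?thesis by (simp add: presented_group_def)
qed

lemma inv_word_cong: "w \<in> words X \<Longrightarrow> (inv_word w @ w, []) \<in> word_cong X R"
proof (induction w)
  case Nil
  then show ?case by (simp add: inv_word_def word_cong.refl)
next
  case (Cons a w)
  obtain b x where a: "a = (b, x)" by (cases a)
  with Cons have x: "x \<in> X" and w: "w \<in> words X" by (auto simp: words_def)
  have "([(\<not> b, x), (\<not> \<not> b, x)] @ w, [] @ w) \<in> word_cong X R"
    by (rule word_cong.append[OF word_cong.cancel[OF x] word_cong.refl])
  then have "(inv_word w @ ([(\<not> b, x), (b, x)] @ w), inv_word w @ w) \<in> word_cong X R"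
    using word_cong.append[OF word_cong.refl] by force
  then have "(inv_word (a # w) @ a # w, inv_word w @ w) \<in> word_cong X R"
    by (simp add: inv_word_def a)
  then show ?case using Cons.IH[OF w] by (rule word_cong.trans)
qed

lemma group_presented_group: "group (presented_group X R)"
proof (rule groupI)
  let ?G = "presented_group X R"
  have c: "A \<in> carrier ?G \<longleftrightarrow> (\<exists>u\<in>words X. A = word_cong X R `` {u})" for A
    by (auto simp: presented_group_def quotient_def)
  have o: "\<one>\<^bsub>?G\<^esub> = word_cong X R `` {[]}" by (simp add: presented_group_def)
  have app: "u @ v \<in> words X" if "u \<in> words X" "v \<in> words X" for u v :: "'a word"
    using that by (auto simp: words_def)
  show "A \<otimes>\<^bsub>?G\<^esub> B \<in> carrier ?G" if "A \<in> carrier ?G" "B \<in> carrier ?G" for A B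
    using that app unfolding c by (auto simp: presented_group_mult)
  show "\<one>\<^bsub>?G\<^esub> \<in> carrier ?G" unfolding c o by (auto simp: words_def)
  show "A \<otimes>\<^bsub>?G\<^esub> B \<otimes>\<^bsub>?G\<^esub> C = A \<otimes>\<^bsub>?G\<^esub> (B \<otimes>\<^bsub>?G\<^esub> C)"
    if "A \<in> carrier ?G" "B \<in> carrier ?G" "C \<in> carrier ?G" for A B C
    using that unfolding c by (auto simp: presented_group_mult)
  show "\<one>\<^bsub>?G\<^esub> \<otimes>\<^bsub>?G\<^esub> A = A" if "A \<in> carrier ?G" for A
    using that unfolding c o by (auto simp: presented_group_mult)
  show "\<exists>B\<in>carrier ?G. B \<otimes>\<^bsub>?G\<^esub> A = \<one>\<^bsub>?G\<^esub>" if A: "A \<in> carrier ?G" for A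
  proof -
    obtain u where u: "u \<in> words X" "A = word_cong X R `` {u}" using A unfolding c by blast
    have "inv_word u \<in> words X" using u(1) by (auto simp: inv_word_def words_def)
    moreover have "word_cong X R `` {inv_word u @ u} = word_cong X R `` {[]}"
      by (rule equiv_class_eq[OF equiv_word_cong inv_word_cong[OF u(1)]])
    ultimately show ?thesis
      unfolding o u(2)
      by (intro bexI[of _ "word_cong X R `` {inv_word u}"]) (auto simp: presented_group_mult c)
  qed
qed


section \<open>Crossed modules\<close>

text \<open>The record carries the data of a crossed module \<open>bdry: src \<rightarrow> tgt\<close>, where \<open>act g m\<close>
  is the action of \<open>g\<close> on \<open>m\<close>.\<close>

record ('m, 'g) xmod =
  src :: "'m monoid"
  tgt :: "'g monoid"
  bdry :: "'m \<Rightarrow> 'g"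
  act :: "'g \<Rightarrow> 'm \<Rightarrow> 'm"

definition crossed_module :: "('m, 'g) xmod \<Rightarrow> bool" where
  "crossed_module X \<longleftrightarrow>
     group (src X) \<and> group (tgt X) \<and> bdry X \<in> hom (src X) (tgt X) \<and>
     (\<forall>g\<in>carrier (tgt X). act X g \<in> iso (src X) (src X)) \<and>
     (\<forall>m\<in>carrier (src X). act X \<one>\<^bsub>tgt X\<^esub> m = m) \<and>
     (\<forall>g\<in>carrier (tgt X). \<forall>h\<in>carrier (tgt X). \<forall>m\<in>carrier (src X).
        act X (g \<otimes>\<^bsub>tgt X\<^esub> h) m = act X g (act X h m)) \<and>
     (\<forall>g\<in>carrier (tgt X). \<forall>m\<in>carrier (src X).
        bdry X (act X g m) = g \<otimes>\<^bsub>tgt X\<^esub> bdry X m \<otimes>\<^bsub>tgt X\<^esub> inv\<^bsub>tgt X\<^esub> g) \<and>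
     (\<forall>m\<in>carrier (src X). \<forall>m'\<in>carrier (src X).
        act X (bdry X m) m' = m \<otimes>\<^bsub>src X\<^esub> m' \<otimes>\<^bsub>src X\<^esub> inv\<^bsub>src X\<^esub> m)"

definition id_xmod :: "'g monoid \<Rightarrow> ('g, 'g) xmod" where
  "id_xmod G = \<lparr>src = G, tgt = G, bdry = (\<lambda>x. x), act = (\<lambda>g x. g \<otimes>\<^bsub>G\<^esub> x \<otimes>\<^bsub>G\<^esub> inv\<^bsub>G\<^esub> g)\<rparr>"

lemma crossed_module_id_xmod:
  fixes G (structure)
  assumes "group G"
  shows "crossed_module (id_xmod G)"
proof -
  interpret group G by fact
  have inv_cancel: "inv g \<otimes> (g \<otimes> x) = x" "g \<otimes> (inv g \<otimes> x) = x"
    if "g \<in> carrier G" "x \<in> carrier G" for g x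
    using that by (simp_all flip: m_assoc)
  have c: "(\<lambda>x. g \<otimes> x \<otimes> inv g) \<in> iso G G" if g: "g \<in> carrier G" for g
  proof (rule isoI)
    show "(\<lambda>x. g \<otimes> x \<otimes> inv g) \<in> hom G G"
      using g by (auto intro!: homI simp: m_assoc inv_cancel)
    show "bij_betw (\<lambda>x. g \<otimes> x \<otimes> inv g) (carrier G) (carrier G)"
      by (rule bij_betw_byWitness[where f' = "\<lambda>x. inv g \<otimes> x \<otimes> g"])
        (use g in \<open>auto simp: m_assoc inv_cancel\<close>)
  qed
  show ?thesis
    using c by (auto simp: crossed_module_def id_xmod_def hom_def inv_mult_group m_assoc)
qed


section \<open>The tensor product modulo q\<close>

datatype ('m, 'n) tgen = Tensor 'm 'n | Brace "'m \<times> 'n"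

definition fibre_product :: "('m, 'g) xmod \<Rightarrow> ('n, 'g) xmod \<Rightarrow> ('m \<times> 'n) set" where
  "fibre_product X Y =
     {k \<in> carrier (src X) \<times> carrier (src Y). bdry X (fst k) = bdry Y (snd k)}"

definition tensor_gens :: "('m, 'g) xmod \<Rightarrow> ('n, 'g) xmod \<Rightarrow> ('m, 'n) tgen set" where
  "tensor_gens X Y =
     {Tensor m n | m n. m \<in> carrier (src X) \<and> n \<in> carrier (src Y)} \<union> Brace ` fibre_product X Y"

text \<open>All actions are taken through the common target group: \<open>m\<close> acts via \<open>bdry X m\<close>, \<open>n\<close> via
  \<open>bdry Y n\<close>, and an element \<open>k\<close> of the fibre product via its image \<open>bdry X (fst k)\<close>. The
  exponent \<open>1 - q + i\<close> in \<open>brace_mult\<close> is an integer, at most 0.\<close>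

inductive_set tensor_rels ::
    "nat \<Rightarrow> ('m, 'g) xmod \<Rightarrow> ('n, 'g) xmod \<Rightarrow> (('m, 'n) tgen word \<times> ('m, 'n) tgen word) set"
  for q :: nat and X :: "('m, 'g) xmod" and Y :: "('n, 'g) xmod" where
  tensor_mult_right:
    "\<lbrakk>m \<in> carrier (src X); n \<in> carrier (src Y); n' \<in> carrier (src Y)\<rbrakk> \<Longrightarrow>
     (letter (Tensor m (n \<otimes>\<^bsub>src Y\<^esub> n')),
      letter (Tensor m n) @ letter (Tensor (act X (bdry Y n) m) (act Y (bdry Y n) n')))
     \<in> tensor_rels q X Y"
| tensor_mult_left:
    "\<lbrakk>m \<in> carrier (src X); m' \<in> carrier (src X); n \<in> carrier (src Y)\<rbrakk> \<Longrightarrow>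
     (letter (Tensor (m \<otimes>\<^bsub>src X\<^esub> m') n),
      letter (Tensor (act X (bdry X m) m') (act Y (bdry X m) n)) @ letter (Tensor m n))
     \<in> tensor_rels q X Y"
| brace_conj:
    "\<lbrakk>k \<in> fibre_product X Y; m \<in> carrier (src X); n \<in> carrier (src Y)\<rbrakk> \<Longrightarrow>
     (letter (Brace k) @ letter (Tensor m n) @ inv_word (letter (Brace k)),
      letter (Tensor (act X (bdry X (fst k) [^]\<^bsub>tgt X\<^esub> q) m)
                     (act Y (bdry X (fst k) [^]\<^bsub>tgt X\<^esub> q) n)))
     \<in> tensor_rels q X Y"
| brace_mult:
    "\<lbrakk>k \<in> fibre_product X Y; k' \<in> fibre_product X Y\<rbrakk> \<Longrightarrow>
     (letter (Brace (k \<otimes>\<^bsub>src X \<times>\<times> src Y\<^esub> k')),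
      letter (Brace k) @
      concat (map (\<lambda>i. letter (Tensor (inv\<^bsub>src X\<^esub> (fst k))
                  (act Y (bdry X (fst k) [^]\<^bsub>tgt X\<^esub> (1 - int q + int i)) (snd k') [^]\<^bsub>src Y\<^esub> i)))
                [1..<q]) @
      letter (Brace k'))
     \<in> tensor_rels q X Y"
| brace_comm:
    "\<lbrakk>k \<in> fibre_product X Y; k' \<in> fibre_product X Y\<rbrakk> \<Longrightarrow>
     (letter (Brace k) @ letter (Brace k') @ inv_word (letter (Brace k)) @ inv_word (letter (Brace k')),
      letter (Tensor (fst k [^]\<^bsub>src X\<^esub> q) (snd k' [^]\<^bsub>src Y\<^esub> q)))
     \<in> tensor_rels q X Y"
| brace_tensor:
    "\<lbrakk>m \<in> carrier (src X); n \<in> carrier (src Y)\<rbrakk> \<Longrightarrow>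
     (letter (Brace (m \<otimes>\<^bsub>src X\<^esub> act X (bdry Y n) (inv\<^bsub>src X\<^esub> m),
                     act Y (bdry X m) n \<otimes>\<^bsub>src Y\<^esub> inv\<^bsub>src Y\<^esub> n)),
      concat (replicate q (letter (Tensor m n))))
     \<in> tensor_rels q X Y"

definition tensor_group ::
    "nat \<Rightarrow> ('m, 'g) xmod \<Rightarrow> ('n, 'g) xmod \<Rightarrow> ('m, 'n) tgen word set monoid" where
  "tensor_group q X Y = presented_group (tensor_gens X Y) (tensor_rels q X Y)"

text \<open>The diagonal action of the target group, and the homomorphism \<open>\<beta>\<close> to \<open>src Y\<close>, defined on
  words and then on classes of words.\<close>

definition tensor_act ::
    "nat \<Rightarrow> ('m, 'g) xmod \<Rightarrow> ('n, 'g) xmod \<Rightarrow> 'g \<Rightarrow>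
     ('m, 'n) tgen word set \<Rightarrow> ('m, 'n) tgen word set" where
  "tensor_act q X Y g A =
     (\<Union>w\<in>A. word_cong (tensor_gens X Y) (tensor_rels q X Y) ``
        {map (\<lambda>(b, x). (b, map_tgen (act X g) (act Y g) x)) w})"

fun gen_bdry :: "nat \<Rightarrow> ('m, 'g) xmod \<Rightarrow> ('n, 'g) xmod \<Rightarrow> ('m, 'n) tgen \<Rightarrow> 'n" where
  "gen_bdry q X Y (Tensor m n) = act Y (bdry X m) n \<otimes>\<^bsub>src Y\<^esub> inv\<^bsub>src Y\<^esub> n"
| "gen_bdry q X Y (Brace k) = snd k [^]\<^bsub>src Y\<^esub> q"

fun word_bdry :: "nat \<Rightarrow> ('m, 'g) xmod \<Rightarrow> ('n, 'g) xmod \<Rightarrow> ('m, 'n) tgen word \<Rightarrow> 'n" where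
  "word_bdry q X Y [] = \<one>\<^bsub>src Y\<^esub>"
| "word_bdry q X Y ((b, x) # w) =
     (if b then gen_bdry q X Y x else inv\<^bsub>src Y\<^esub> (gen_bdry q X Y x)) \<otimes>\<^bsub>src Y\<^esub> word_bdry q X Y w"

definition tensor_bdry ::
    "nat \<Rightarrow> ('m, 'g) xmod \<Rightarrow> ('n, 'g) xmod \<Rightarrow> ('m, 'n) tgen word set \<Rightarrow> 'n" where
  "tensor_bdry q X Y A = the_elem (word_bdry q X Y ` A)"

definition tensor_xmod ::
    "nat \<Rightarrow> ('m, 'g) xmod \<Rightarrow> ('n, 'g) xmod \<Rightarrow> (('m, 'n) tgen word set, 'n) xmod" where
  "tensor_xmod q X Y =
     \<lparr>src = tensor_group q X Y, tgt = src Y, bdry = tensor_bdry q X Y,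
      act = (\<lambda>n. tensor_act q X Y (bdry Y n))\<rparr>"


section \<open>Iterating the construction\<close>

text \<open>Every tensor product changes the type of the elements. To iterate it an arbitrary number of
  times, each group is replaced by an isomorphic copy whose elements lie in the one type
  \<open>'a univ\<close>: an element of \<open>G\<close> is tagged with \<open>Base\<close>, and a class of words is replaced by a
  chosen representative (tagged with \<open>Word\<close>). Distinct classes are disjoint, so this relabelling
  is injective.\<close>

datatype 'a univ = Base 'a | Word "(bool \<times> ('a univ, 'a univ) tgen) list"

definition label :: "('a univ, 'a univ) tgen word set \<Rightarrow> 'a univ" where
  "label A = Word (SOME w. w \<in> A)"

lemma inj_on_label: "inj_on label (carrier (tensor_group q X Y))"
proof (rule inj_onI)
  fix A B
  assume "A \<in> carrier (tensor_group q X Y)" "B \<in> carrier (tensor_group q X Y)" "label A = label B"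
  let ?r = "word_cong (tensor_gens X Y) (tensor_rels q X Y)"
  from \<open>label A = label B\<close> have eq: "(SOME w. w \<in> A) = (SOME w. w \<in> B)"
    by (simp add: label_def)
  have "A \<in> UNIV // ?r" "B \<in> UNIV // ?r"
    using \<open>A \<in> _\<close> \<open>B \<in> _\<close>
    by (auto simp: tensor_group_def presented_group_def quotient_def)
  moreover from this have "(SOME w. w \<in> A) \<in> A" "(SOME w. w \<in> B) \<in> B"
    using in_quotient_imp_non_empty[OF equiv_word_cong] by (metis some_in_eq)+
  ultimately show "A = B"
    using quotient_disj[OF equiv_word_cong] eq by (metis disjoint_iff)
qed

definition relabel_xmod :: "('m \<Rightarrow> 'c) \<Rightarrow> ('m, 'g) xmod \<Rightarrow> ('c, 'g) xmod" where
  "relabel_xmod f X =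
     (let f' = inv_into (carrier (src X)) f in
      \<lparr>src = image_group f (src X), tgt = tgt X, bdry = (\<lambda>y. bdry X (f' y)),
       act = (\<lambda>g y. f (act X g (f' y)))\<rparr>)"

definition base_group :: "'a monoid \<Rightarrow> 'a univ monoid" where
  "base_group G = image_group Base G"

text \<open>Both sequences start at index 1 (the value at 0 is the same as at 1, and irrelevant).\<close>

definition nfold_xmod :: "nat \<Rightarrow> 'a monoid \<Rightarrow> nat \<Rightarrow> ('a univ, 'a univ) xmod" where
  "nfold_xmod q G n =
     ((\<lambda>X. relabel_xmod label (tensor_xmod q X (id_xmod (base_group G)))) ^^ (n - 1))
       (id_xmod (base_group G))"

definition nfold_tensor :: "nat \<Rightarrow> 'a monoid \<Rightarrow> nat \<Rightarrow> 'a univ monoid" where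
  "nfold_tensor q G n = src (nfold_xmod q G n)"

definition iterated_tensor :: "nat \<Rightarrow> 'a monoid \<Rightarrow> nat \<Rightarrow> 'a univ monoid" where
  "iterated_tensor q G n =
     ((\<lambda>H. image_group label (tensor_group q (id_xmod H) (id_xmod H))) ^^ (n - 1)) (base_group G)"

end

theory Submission
  imports Defs "HOL-Algebra.Group_Action" "HOL-Algebra.Sylow" "HOL-Algebra.Zassenhaus"
    "HOL-Algebra.Multiplicative_Group"
begin

text \<open>
  Call a crossed module \<open>\<mu>: M \<rightarrow> G\<close> of finite \<open>p\<close>-groups powerful if \<open>[G,M] \<le> M\<^sup>p\<close>. This makes \<open>M\<close>
  powerful, it holds for \<open>id: G \<rightarrow> G\<close> if \<open>G\<close> is powerful, and it is inherited by
  \<open>\<beta>: T = M \<otimes>\<^sup>p G \<rightarrow> G\<close>, as follows.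

  For odd \<open>p\<close> the map \<open>m \<mapsto> {m}\<close> is multiplicative on cyclic subgroups, and \<open>(m \<otimes> n)\<^sup>p\<close> is some \<open>{m'}\<close>, so
  the generators of \<open>T\<close> have \<open>p\<close>-power order. They form a finite set that is closed under conjugation
  (\<open>T\<close> acts on itself through \<open>G\<close>), hence \<open>T\<close> is finite by Dietzmann's lemma, and it is a \<open>p\<close>-group
  since the kernel of \<open>\<beta>\<close> is central.

  The commutators \<open>[G,T]\<close> come from \<open>[M,G] \<otimes> G\<close> and from \<open>\<^sup>g{m} = (m\<^sup>p \<otimes> g)\<^sup>-\<^sup>1 {m}\<close>, so it suffices
  that \<open>m\<^sup>p \<otimes> g\<close> lies in \<open>T\<^sup>p\<close>. As \<open>G\<close> acts nilpotently on \<open>T\<close>, one may compute modulo \<open>T\<^sup>p [G,[G,T]]\<close>,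
  where \<open>m\<^sup>p \<otimes> g\<close> is the product of \<open>(m \<otimes> g)\<^sup>p\<close> and a central element to the power \<open>p(p-1)/2\<close>.
\<close>


section \<open>Finite p-groups acting on finite p-groups\<close>

text \<open>The induction carries the condition on [G,M] because, up to inversion, the displacement
  of m \<otimes> n under y is w \<otimes> y, where w = m(^n m^-1) is a displacement in M under G.
  Knowing commutators inside M alone would not control it. One inductive step serves both sequences;
  the iterated one restarts each time from an identity crossed module. Comparing m^p \<otimes> g
  with (m \<otimes> g)^p costs an error in [G,[G,T]], which is not known beforehand to lie in T^p. A
  descent through invariant subgroups removes it: a p-group acting on a nontrivial p-group has a
  fixed element besides 1. The formula for ^g{m} comes from writing ^g m = xm: the tensors in the
  relation for {xm} telescope, and {x} is a pth power of the inverse of a tensor. It must be found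
  while the Peiffer identity for \<beta> is known on tensors only, since the cases with two braces,
  and with a tensor acting on a brace, are deduced from it. That \<beta> is again a crossed module
  is proved along the way.\<close>

lemma (in group_action) another_fixed_point:
  assumes p: "prime p" and G: "finite_p_group p G"
    and E: "finite E" "p dvd card E"
    and x: "x \<in> E" "\<And>g. g \<in> carrier G \<Longrightarrow> \<phi> g x = x"
  obtains y where "y \<in> E" "y \<noteq> x" "\<And>g. g \<in> carrier G \<Longrightarrow> \<phi> g y = y"
proof -
  obtain a where a: "order G = p ^ a" using G by (auto simp: finite_p_group_def)
  have "\<exists>y\<in>E. y \<noteq> x \<and> (\<forall>g\<in>carrier G. \<phi> g y = y)"
  proof (rule ccontr)
    assume no: "\<not> ?thesis"
    have orbx: "orbit G \<phi> x = {x}"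
      using x orbit_refl[OF x(1)] by (auto simp: orbit_def)
    \<comment> \<open>Orbit sizes are powers of \<open>p\<close>, and an orbit of size 1 would be a
      second fixed point. Hence \<open>card E\<close> would be 1 modulo \<open>p\<close>.\<close>
    have big: "p dvd card (orbit G \<phi> y)" if y: "y \<in> E" "y \<noteq> x" for y
    proof -
      have "card (orbit G \<phi> y) dvd p ^ a"
        using orbit_stabilizer_theorem[OF y(1)] a by (metis dvd_triv_left)
      then obtain k where k: "card (orbit G \<phi> y) = p ^ k"
        using p by (metis divides_primepow_nat)
      show ?thesis
      proof (cases "k = 0")
        case True
        then obtain z where "orbit G \<phi> y = {z}" using k by (auto simp: card_1_singleton_iff)
        with orbit_refl[OF y(1)] have "orbit G \<phi> y = {y}" by auto
        then have "\<forall>g\<in>carrier G. \<phi> g y = y" by (auto simp: orbit_def)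
        with no y show ?thesis by blast
      qed (use k in auto)
    qed
    have fin: "finite (orbits G E \<phi>)" using E by (auto simp: orbits_def)
    have xo: "{x} \<in> orbits G E \<phi>" using x(1) orbx unfolding orbits_def by blast
    have "card E = (\<Sum>Q\<in>orbits G E \<phi>. card Q)"
      using disjoint_sum[OF E(1), of "\<lambda>_. 1::nat"] by simp
    also have "\<dots> = 1 + (\<Sum>Q\<in>orbits G E \<phi> - {{x}}. card Q)"
      using sum.remove[OF fin xo, of card] by simp
    finally have "card E = 1 + (\<Sum>Q\<in>orbits G E \<phi> - {{x}}. card Q)" .
    moreover have "p dvd (\<Sum>Q\<in>orbits G E \<phi> - {{x}}. card Q)"
    proof (rule dvd_sum)
      fix Q assume Q: "Q \<in> orbits G E \<phi> - {{x}}"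
      then obtain y where "y \<in> E" "Q = orbit G \<phi> y" by (auto simp: orbits_def)
      with Q orbx big show "p dvd card Q" by auto
    qed
    ultimately have "p dvd 1" using E(2) by (metis dvd_add_left_iff)
    with p show False by simp
  qed
  with that show ?thesis by blast
qed


lemma (in group) inv_mult_cancel:
  assumes "a \<in> carrier G" "b \<in> carrier G"
  shows "inv a \<otimes> (a \<otimes> b) = b" "a \<otimes> (inv a \<otimes> b) = b"
  using assms by (simp_all flip: m_assoc)


text \<open>The maps \<open>ac g\<close> are only asked to be endomorphisms; \<open>ac_one\<close>
  and \<open>ac_mult\<close> make \<open>ac (inv g)\<close> the inverse of \<open>ac g\<close>,
  whence \<open>ac_iso\<close>.\<close>

locale aut_action = T: group T + G: group G
  for T (structure) and G (structure) +
  fixes ac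
  assumes ac_hom: "g \<in> carrier G \<Longrightarrow> ac g \<in> hom T T"
    and ac_one: "t \<in> carrier T \<Longrightarrow> ac \<one>\<^bsub>G\<^esub> t = t"
    and ac_mult: "\<lbrakk>g \<in> carrier G; h \<in> carrier G; t \<in> carrier T\<rbrakk> \<Longrightarrow> ac (g \<otimes>\<^bsub>G\<^esub> h) t = ac g (ac h t)"
begin

lemma ac_closed [simp, intro]: "\<lbrakk>g \<in> carrier G; t \<in> carrier T\<rbrakk> \<Longrightarrow> ac g t \<in> carrier T"
  using ac_hom by (auto simp: hom_def)

lemma ac_distrib: "\<lbrakk>g \<in> carrier G; s \<in> carrier T; t \<in> carrier T\<rbrakk> \<Longrightarrow> ac g (s \<otimes> t) = ac g s \<otimes> ac g t"
  using ac_hom by (auto simp: hom_def)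

lemma ac_group_hom: "g \<in> carrier G \<Longrightarrow> group_hom T T (ac g)"
  by (simp add: group_hom_def group_hom_axioms_def ac_hom)

lemma ac_unit [simp]: "g \<in> carrier G \<Longrightarrow> ac g \<one> = \<one>"
  using group_hom.hom_one[OF ac_group_hom] .

lemma ac_inv: "\<lbrakk>g \<in> carrier G; t \<in> carrier T\<rbrakk> \<Longrightarrow> ac g (inv t) = inv (ac g t)"
  using group_hom.hom_inv[OF ac_group_hom] .

lemma ac_pow: "\<lbrakk>g \<in> carrier G; t \<in> carrier T\<rbrakk> \<Longrightarrow> ac g (t [^] (n::nat)) = ac g t [^] n"
  using group_hom.hom_nat_pow[OF ac_group_hom] .

lemma ac_cancel [simp]:
  "\<lbrakk>g \<in> carrier G; t \<in> carrier T\<rbrakk> \<Longrightarrow> ac (inv\<^bsub>G\<^esub> g) (ac g t) = t"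
  "\<lbrakk>g \<in> carrier G; t \<in> carrier T\<rbrakk> \<Longrightarrow> ac g (ac (inv\<^bsub>G\<^esub> g) t) = t"
  by (simp_all flip: ac_mult add: ac_one)

lemma ac_iso: "g \<in> carrier G \<Longrightarrow> ac g \<in> iso T T"
  by (intro isoI ac_hom bij_betw_byWitness[where f' = "ac (inv\<^bsub>G\<^esub> g)"]) auto

definition invariant :: "'a set \<Rightarrow> bool" where
  "invariant B \<longleftrightarrow> (\<forall>g\<in>carrier G. ac g ` B \<subseteq> B)"

lemma ac_image_invariant:
  assumes "subgroup B T" "invariant B" "g \<in> carrier G"
  shows "ac g ` B = B"
proof
  show "B \<subseteq> ac g ` B"
  proof
    fix b assume b: "b \<in> B"
    then have "b = ac g (ac (inv\<^bsub>G\<^esub> g) b)"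
      using assms subgroup.mem_carrier by fastforce
    moreover have "ac (inv\<^bsub>G\<^esub> g) b \<in> B" using assms b by (auto simp: invariant_def)
    ultimately show "b \<in> ac g ` B" by blast
  qed
qed (use assms in \<open>auto simp: invariant_def\<close>)

text \<open>\<open>G\<close> permutes the right cosets of \<open>C\<close> in \<open>B\<close> and
  fixes \<open>C\<close> itself. Their number is a power of \<open>p\<close> other than 1, so orbit
  counting yields a second fixed coset \<open>Cb\<close>, and this says that \<open>G\<close> moves
  \<open>b\<close> only by elements of \<open>C\<close>.\<close>

lemma another_fixed_coset:
  assumes p: "prime p" and G: "finite_p_group p G" and T: "finite_p_group p T"
    and B: "subgroup B T" "invariant B" and C: "subgroup C T" "invariant C" and "C \<subset> B"
  obtains b where "b \<in> B - C" "\<And>g. g \<in> carrier G \<Longrightarrow> ac g b \<otimes> inv b \<in> C"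
proof -
  define E where "E = (\<lambda>b. C #> b) ` B"
  have Bc: "B \<subseteq> carrier T" and Cc: "C \<subseteq> carrier T" using B C by (auto dest: subgroup.subset)
  have finB: "finite B" using T Bc by (auto simp: finite_p_group_def intro: finite_subset)
  have act: "ac g ` (C #> b) = C #> ac g b" if g: "g \<in> carrier G" and b: "b \<in> B" for g b
  proof -
    have "ac g ` (C #> b) = (\<lambda>c. c \<otimes> ac g b) ` (ac g ` C)"
      using g b Bc Cc by (force simp: r_coset_def ac_distrib subset_iff)
    then show ?thesis using ac_image_invariant[OF C g] by (auto simp: r_coset_def)
  qed
  have mem: "ac g ` X \<in> E" if "g \<in> carrier G" "X \<in> E" for g X
    using that B(2) by (force simp: E_def invariant_def act)
  have Esub: "x \<in> carrier T" if "X \<in> E" "x \<in> X" for X x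
    using that Bc T.r_coset_subset_G[OF Cc] unfolding E_def by blast
  have comp: "ac (g \<otimes>\<^bsub>G\<^esub> h) ` X = ac g ` (ac h ` X)"
    if "g \<in> carrier G" "h \<in> carrier G" "X \<in> E" for g h X
    unfolding image_image using that Esub by (intro image_cong[OF HOL.refl] ac_mult)
  have one: "ac \<one>\<^bsub>G\<^esub> ` X = X" if "X \<in> E" for X
    using image_cong[of X X "ac \<one>\<^bsub>G\<^esub>" id] Esub[OF that] ac_one by simp
  \<comment> \<open>The restriction to \<open>E\<close> is there because \<open>Bij E\<close>
    consists of extensional maps.\<close>
  define \<phi> where "\<phi> g = (\<lambda>X\<in>E. ac g ` X)" for g
  have bij: "\<phi> g \<in> Bij E" if g: "g \<in> carrier G" for g
    unfolding Bij_def \<phi>_def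
  proof (intro IntI restrict_extensional CollectI bij_betw_byWitness[where f' = "\<lambda>X. ac (inv\<^bsub>G\<^esub> g) ` X"])
    show "\<forall>X\<in>E. ac (inv\<^bsub>G\<^esub> g) ` (\<lambda>X\<in>E. ac g ` X) X = X"
      using g by (auto simp flip: comp simp: one)
    show "\<forall>X\<in>E. (\<lambda>X\<in>E. ac g ` X) (ac (inv\<^bsub>G\<^esub> g) ` X) = X"
      using g by (auto simp flip: comp simp: one mem)
  qed (use g mem in auto)
  have "\<phi> \<in> hom G (BijGroup E)"
    by (rule homI) (auto simp: bij BijGroup_def, auto simp: \<phi>_def compose_def comp mem restrict_def fun_eq_iff)
  then interpret A: group_action G E \<phi>
    by (simp add: group_action_def group_hom_def group_hom_axioms_def group_BijGroup)
  interpret B: group "T\<lparr>carrier := B\<rparr>" by (rule T.subgroup_imp_group[OF B(1)])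
  have "subgroup C (T\<lparr>carrier := B\<rparr>)"
    using T.subgroup_incl[OF C(1) B(1)] \<open>C \<subset> B\<close> by auto
  then have "card (rcosets\<^bsub>T\<lparr>carrier := B\<rparr>\<^esub> C) * card C = card B"
    using B.lagrange[of C] by (simp add: order_def)
  moreover have "rcosets\<^bsub>T\<lparr>carrier := B\<rparr>\<^esub> C = E"
    by (auto simp: E_def RCOSETS_def r_coset_def)
  ultimately have cE: "card E * card C = card B" by simp
  obtain a where "order T = p ^ a" using T by (auto simp: finite_p_group_def)
  moreover have "card B dvd order T" using T.lagrange[OF B(1)] by (metis dvd_triv_right)
  ultimately have "card E dvd p ^ a" using cE by (metis dvd_mult_left dvd_trans dvd_triv_left)
  then obtain k where k: "card E = p ^ k" using p by (metis divides_primepow_nat)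
  have "card C < card B" using \<open>C \<subset> B\<close> finB by (rule psubset_card_mono[rotated])
  then have "card E \<noteq> 1" using cE by auto
  then have "p dvd card E" using k by (cases k) auto
  have CE: "C \<in> E"
    using T.coset_mult_one[OF Cc] subgroup.one_closed[OF B(1)] unfolding E_def by (metis image_eqI)
  have "\<phi> g C = C" if "g \<in> carrier G" for g
    using that CE ac_image_invariant[OF C] by (simp add: \<phi>_def)
  with A.another_fixed_point[OF p G _ \<open>p dvd card E\<close> CE] finB
  obtain Y where Y: "Y \<in> E" "Y \<noteq> C" "\<And>g. g \<in> carrier G \<Longrightarrow> \<phi> g Y = Y"
    by (metis E_def finite_imageI)
  then obtain b where b: "b \<in> B" "Y = C #> b" by (auto simp: E_def)
  have bc: "b \<in> carrier T" using b Bc by auto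
  have "ac g b \<otimes> inv b \<in> C" if g: "g \<in> carrier G" for g
  proof -
    have "C #> ac g b = C #> b" using Y(3)[OF g] Y(1) b act[OF g b(1)] by (simp add: \<phi>_def)
    then have "ac g b \<in> C #> b"
      using T.rcos_self[OF ac_closed[OF g bc] C(1)] by simp
    then obtain c where "c \<in> C" "ac g b = c \<otimes> b" by (auto simp: r_coset_def)
    then show ?thesis using bc Cc by (auto simp: T.m_assoc subset_iff)
  qed
  moreover have "b \<notin> C"
    using T.coset_join2[OF bc C(1)] Y(2) b by auto
  ultimately show ?thesis using that b by blast
qed

text \<open>The displacement of a product ab is the displacement of a times a conjugate of that of
  b, and \<open>C\<close> is normal. This is what allows statements about displacements to be
  checked on generators only.\<close>

lemma fixed_mod_subgroup:
  assumes B: "subgroup B T" and C: "C \<lhd> T"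
  shows "subgroup {b \<in> B. \<forall>g\<in>carrier G. ac g b \<otimes> inv b \<in> C} T"
proof -
  interpret B: subgroup B T by fact
  interpret C: normal C T by fact
  note [simp] = B.mem_carrier T.m_assoc T.inv_mult_group
  show ?thesis
  proof (rule T.subgroupI)
    show "{b \<in> B. \<forall>g\<in>carrier G. ac g b \<otimes> inv b \<in> C} \<noteq> {}"
      using B.one_closed by (auto intro!: exI[of _ \<one>])
  next
    fix b assume b: "b \<in> {b \<in> B. \<forall>g\<in>carrier G. ac g b \<otimes> inv b \<in> C}"
    have "ac g (inv b) \<otimes> inv (inv b) \<in> C" if g: "g \<in> carrier G" for g
    proof -
      have "inv b \<otimes> (inv (ac g b \<otimes> inv b)) \<otimes> inv (inv b) \<in> C"
        using b g by (intro C.inv_op_closed2 C.m_inv_closed) auto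
      also have "inv b \<otimes> (inv (ac g b \<otimes> inv b)) \<otimes> inv (inv b) = ac g (inv b) \<otimes> inv (inv b)"
        using b g by (simp add: ac_inv flip: T.m_assoc)
      finally show ?thesis .
    qed
    then show "inv b \<in> {b \<in> B. \<forall>g\<in>carrier G. ac g b \<otimes> inv b \<in> C}" using b by auto
  next
    fix a b assume a: "a \<in> {b \<in> B. \<forall>g\<in>carrier G. ac g b \<otimes> inv b \<in> C}"
      and b: "b \<in> {b \<in> B. \<forall>g\<in>carrier G. ac g b \<otimes> inv b \<in> C}"
    have "ac g (a \<otimes> b) \<otimes> inv (a \<otimes> b) \<in> C" if g: "g \<in> carrier G" for g
    proof -
      have "(ac g a \<otimes> inv a) \<otimes> (a \<otimes> (ac g b \<otimes> inv b) \<otimes> inv a) \<in> C"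
        using a b g by (intro C.m_closed[OF _ C.inv_op_closed2]) auto
      also have "(ac g a \<otimes> inv a) \<otimes> (a \<otimes> (ac g b \<otimes> inv b) \<otimes> inv a) = ac g (a \<otimes> b) \<otimes> inv (a \<otimes> b)"
        using a b g by (simp add: ac_distrib T.inv_mult_cancel)
      finally show ?thesis .
    qed
    then show "a \<otimes> b \<in> {b \<in> B. \<forall>g\<in>carrier G. ac g b \<otimes> inv b \<in> C}" using a b by auto
  qed auto
qed

end


section \<open>Generation by torsion elements\<close>

context aut_action
begin

text \<open>To prove [G,T] \<le> N it suffices to prove [G,T] \<le> B under the extra assumption
  [G,[G,T]] \<le> B, for every invariant B above N. Take B smallest among the invariant subgroups
  containing N and [G,T]. If B were not N, take C largest among the invariant subgroups with N \<le>
  C < B. By maximality \<open>G\<close> acts trivially on B/C, so [G,[G,T]] \<le> C, and the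
  assumption \<open>step\<close> puts [G,T] into C, against the choice of B. The hypothesis
  \<open>inner\<close> makes invariant subgroups normal.\<close>

lemma commutators_in_subgroup:
  assumes p: "prime p" and G: "finite_p_group p G" and T: "finite_p_group p T"
    and inner: "\<And>t. t \<in> carrier T \<Longrightarrow> \<exists>g\<in>carrier G. \<forall>s\<in>carrier T. ac g s = t \<otimes> s \<otimes> inv t"
    and N: "subgroup N T" "invariant N"
    and step: "\<And>B. \<lbrakk>subgroup B T; invariant B; N \<subseteq> B;
        \<And>g h t. \<lbrakk>g \<in> carrier G; h \<in> carrier G; t \<in> carrier T\<rbrakk> \<Longrightarrow>
          ac h (ac g t \<otimes> inv t) \<otimes> inv (ac g t \<otimes> inv t) \<in> B\<rbrakk> \<Longrightarrow>
        \<forall>g\<in>carrier G. \<forall>t\<in>carrier T. ac g t \<otimes> inv t \<in> B"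
    and "g \<in> carrier G" "t \<in> carrier T"
  shows "ac g t \<otimes> inv t \<in> N"
proof -
  have fin: "finite (carrier T)" using T by (simp add: finite_p_group_def)
  have card_less: "card C < card B" if "C \<subset> B" "subgroup B T" for B C
    using that fin by (metis finite_subset psubset_card_mono subgroup.subset)
  have nrml: "B \<lhd> T" if "subgroup B T" "invariant B" for B
  proof (rule T.normal_invI[OF that(1)])
    fix t b assume "t \<in> carrier T" "b \<in> B"
    moreover from this obtain h where "h \<in> carrier G" "\<forall>s\<in>carrier T. ac h s = t \<otimes> s \<otimes> inv t"
      using inner by blast
    ultimately show "t \<otimes> b \<otimes> inv t \<in> B"
      using that subgroup.mem_carrier[OF that(1)] unfolding invariant_def by (metis imageI subsetD)
  qed
  define P where "P B \<longleftrightarrow> subgroup B T \<and> invariant B \<and> N \<subseteq> B \<and>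
    (\<forall>g\<in>carrier G. \<forall>t\<in>carrier T. ac g t \<otimes> inv t \<in> B)" for B
  have "P (carrier T)"
    using N T.subgroup_self by (auto simp: P_def invariant_def dest: subgroup.subset)
  then obtain B where B: "P B" and minB: "\<And>C. P C \<Longrightarrow> card B \<le> card C"
    using ex_has_least_nat[of P "carrier T" card] by blast
  have "B = N"
  proof (rule ccontr)
    assume "B \<noteq> N"
    define Q where "Q C \<longleftrightarrow> subgroup C T \<and> invariant C \<and> N \<subseteq> C \<and> C \<subset> B" for C
    have "Q N" using N B \<open>B \<noteq> N\<close> by (auto simp: Q_def P_def)
    moreover have "\<forall>C. Q C \<longrightarrow> card C < Suc (card B)"
      using card_less B by (auto simp: Q_def P_def less_Suc_eq)
    ultimately obtain C where C: "Q C" and maxC: "\<And>D. Q D \<Longrightarrow> card D \<le> card C"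
      using ex_has_greatest_nat[of Q N card "Suc (card B)"] by blast
    have Cn: "C \<lhd> T" using C nrml by (simp add: Q_def)
    interpret C: normal C T by fact
    define F where "F = {b \<in> B. \<forall>g\<in>carrier G. ac g b \<otimes> inv b \<in> C}"
    have Bs: "subgroup B T" and Bi: "invariant B" and Ci: "invariant C" and CB: "C \<subset> B"
      using B C by (auto simp: P_def Q_def)
    have Bc: "b \<in> carrier T" if "b \<in> B" for b using Bs that by (rule subgroup.mem_carrier)
    have F: "subgroup F T" unfolding F_def by (rule fixed_mod_subgroup[OF Bs Cn])
    have "invariant F"
      unfolding invariant_def
    proof clarify
      fix h b assume h: "h \<in> carrier G" and b: "b \<in> F"
      then have bB: "b \<in> B" by (simp add: F_def)
      have "ac g (ac h b) \<otimes> inv (ac h b) \<in> C" if g: "g \<in> carrier G" for g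
      proof -
        \<comment> \<open>Conjugating \<open>g\<close> by the inverse of \<open>h\<close> turns the
          displacement of \<open>ac h b\<close> under \<open>g\<close> into the image under
          \<open>ac h\<close> of a displacement of \<open>b\<close>.\<close>
        let ?k = "inv\<^bsub>G\<^esub> h \<otimes>\<^bsub>G\<^esub> (g \<otimes>\<^bsub>G\<^esub> h)"
        have "?k \<in> carrier G" using g h by simp
        then have "ac ?k b \<otimes> inv b \<in> C" using b unfolding F_def by blast
        then have "ac h (ac ?k b \<otimes> inv b) \<in> C" using h Ci unfolding invariant_def by blast
        also have "ac h (ac ?k b \<otimes> inv b) = ac g (ac h b) \<otimes> inv (ac h b)"
          using g h bB Bc by (simp add: ac_distrib ac_mult ac_inv)
        finally show ?thesis .
      qed
      then show "ac h b \<in> F" using h bB Bi by (auto simp: F_def invariant_def)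
    qed
    moreover have "C \<subseteq> F"
      using CB Ci by (auto simp: F_def invariant_def)
    moreover obtain b where "b \<in> B - C" "\<And>g. g \<in> carrier G \<Longrightarrow> ac g b \<otimes> inv b \<in> C"
      using another_fixed_coset[OF p G T Bs Bi C.is_subgroup Ci CB] by blast
    then have "C \<subset> F" using \<open>C \<subseteq> F\<close> by (auto simp: F_def)
    \<comment> \<open>\<open>F\<close> is invariant and strictly larger than \<open>C\<close>, so a
      proper inclusion in \<open>B\<close> would contradict the maximality of
      \<open>C\<close>.\<close>
    ultimately have "\<not> F \<subset> B"
      using maxC[of F] card_less[OF \<open>C \<subset> F\<close> F] F C by (auto simp: Q_def)
    then have "F = B" by (auto simp: F_def)
    \<comment> \<open>\<open>F = B\<close> means [G,B] \<le> C. All displacements lie in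
      \<open>B\<close>, so their own displacements lie in \<open>C\<close> and \<open>step\<close>
      applies to \<open>C\<close>.\<close>
    have "P C"
      using step[OF C.is_subgroup Ci] C B \<open>F = B\<close> unfolding F_def P_def Q_def by blast
    then show False using minB[of C] card_less[OF CB Bs] by simp
  qed
  then show ?thesis using B assms by (auto simp: P_def)
qed

end


section \<open>Ordered products and finiteness of groups generated by torsion elements\<close>

definition listprod :: "('a, 'b) monoid_scheme \<Rightarrow> 'a list \<Rightarrow> 'a" where
  "listprod G xs = foldr (\<lambda>x y. x \<otimes>\<^bsub>G\<^esub> y) xs \<one>\<^bsub>G\<^esub>"

lemma listprod_simps [simp]:
  "listprod G [] = \<one>\<^bsub>G\<^esub>"
  "listprod G (x # xs) = x \<otimes>\<^bsub>G\<^esub> listprod G xs"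
  by (simp_all add: listprod_def)

context group
begin

lemma listprod_closed [simp, intro]: "set xs \<subseteq> carrier G \<Longrightarrow> listprod G xs \<in> carrier G"
  by (induction xs) auto

lemma listprod_append:
  "\<lbrakk>set xs \<subseteq> carrier G; set ys \<subseteq> carrier G\<rbrakk> \<Longrightarrow> listprod G (xs @ ys) = listprod G xs \<otimes> listprod G ys"
  by (induction xs) (auto simp: m_assoc)

lemma listprod_replicate: "x \<in> carrier G \<Longrightarrow> listprod G (replicate n x) = x [^] n"
  by (induction n) (simp_all flip: nat_pow_Suc2)

lemma listprod_conj:
  assumes "a \<in> carrier G" "set xs \<subseteq> carrier G"
  shows "listprod G xs \<otimes> a = a \<otimes> listprod G (map (\<lambda>x. inv a \<otimes> x \<otimes> a) xs)"
  using assms(2)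
proof (induction xs)
  case (Cons x xs)
  then have "x \<otimes> listprod G xs \<otimes> a = x \<otimes> (a \<otimes> listprod G (map (\<lambda>x. inv a \<otimes> x \<otimes> a) xs))"
    using assms(1) by (simp add: m_assoc)
  moreover have "set (map (\<lambda>x. inv a \<otimes> x \<otimes> a) xs) \<subseteq> carrier G" using Cons.prems assms(1) by auto
  ultimately show ?case using Cons.prems assms(1) by (simp add: m_assoc inv_mult_cancel)
qed (use assms in simp)

text \<open>Dietzmann's lemma: in a long product of elements of \<open>S\<close> some element occurs \<open>e\<close> times, and
  these occurrences can be collected at the front, conjugating the other factors.\<close>

lemma finite_generate_torsion:
  fixes e :: nat
  assumes S: "finite S" "S \<subseteq> carrier G"
    and cjg: "\<And>s t. \<lbrakk>s \<in> S; t \<in> carrier G\<rbrakk> \<Longrightarrow> t \<otimes> s \<otimes> inv t \<in> S"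
    and e: "e > 0" "\<And>s. s \<in> S \<Longrightarrow> s [^] e = \<one>"
  shows "finite (generate G S)"
proof -
  have collect: "\<exists>ys\<in>lists S. length ys + k = length xs \<and> listprod G xs = s [^] k \<otimes> listprod G ys"
    if "s \<in> S" "xs \<in> lists S" "k \<le> count_list xs s" for s xs k
    using that(2,3)
  proof (induction k arbitrary: xs)
    case 0
    then have "set xs \<subseteq> carrier G" using S by auto
    then show ?case using 0 by (intro bexI[of _ xs]) auto
  next
    case (Suc k)
    then have "s \<in> set xs" by (metis count_notin not_less_eq_eq zero_le)
    then obtain us vs where xs: "xs = us @ s # vs" "s \<notin> set us" by (metis split_list_first)
    let ?c = "\<lambda>x. inv s \<otimes> x \<otimes> s"
    have sc: "s \<in> carrier G" using that S by auto
    have usc: "set us \<subseteq> S" "set vs \<subseteq> S" using Suc.prems xs by auto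
    let ?ys = "map ?c us @ vs"
    have cc: "?c x \<in> S" if "x \<in> S" for x using cjg[OF that, of "inv s"] sc by simp
    have ysS: "?ys \<in> lists S" using usc cc by fastforce
    \<comment> \<open>Conjugation by \<open>s\<close> maps nothing but \<open>s\<close> to
      \<open>s\<close>, and \<open>us\<close> stops before the first \<open>s\<close>. So exactly
      one occurrence is lost in passing from \<open>xs\<close> to \<open>?ys\<close>.\<close>
    have "?c x \<noteq> s" if "x \<in> set us" for x
    proof
      assume "?c x = s"
      then have "s \<otimes> ?c x = s \<otimes> s" by simp
      then have "x = s" using usc S sc that by (simp add: m_assoc inv_mult_cancel subset_iff)
      then show False using xs(2) that by simp
    qed
    then have "s \<notin> set (map ?c us)" by (metis (no_types, lifting) imageE set_map)
    then have "count_list (map ?c us) s = 0" by (rule count_notin)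
    then have "k \<le> count_list ?ys s" using Suc.prems xs by simp
    from Suc.IH[OF ysS this] obtain zs where zs: "zs \<in> lists S" "length zs + k = length ?ys"
      "listprod G ?ys = s [^] k \<otimes> listprod G zs" by blast
    have "listprod G xs = (listprod G us \<otimes> s) \<otimes> listprod G vs"
      using xs usc S sc by (auto simp: listprod_append m_assoc)
    also have "\<dots> = s \<otimes> listprod G ?ys"
    proof -
      have "set (map ?c us) \<subseteq> carrier G" "set us \<subseteq> carrier G" "set vs \<subseteq> carrier G"
        using usc S sc by auto
      then show ?thesis
        using sc by (simp add: listprod_append listprod_conj m_assoc del: set_map)
    qed
    also have "\<dots> = s [^] Suc k \<otimes> listprod G zs"
    proof -
      have "set zs \<subseteq> carrier G" using zs(1) S by auto
      then show ?thesis using zs(3) sc nat_pow_Suc2[OF sc, of k] by (simp add: m_assoc)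
    qed
    finally show ?case using zs xs by (intro bexI[of _ zs]) auto
  qed
  let ?L = "{xs. set xs \<subseteq> S \<and> length xs \<le> card S * (e - 1)}"
  have short: "\<exists>ys\<in>?L. listprod G xs = listprod G ys" if "xs \<in> lists S" for xs
    using that
  proof (induction "length xs" arbitrary: xs rule: less_induct)
    case less
    show ?case
    proof (cases "length xs \<le> card S * (e - 1)")
      case False
      have "\<exists>s\<in>S. e \<le> count_list xs s"
      proof (rule ccontr)
        assume "\<not> ?thesis"
        then have "count_list xs s \<le> e - 1" if "s \<in> S" for s using that by force
        then have "(\<Sum>s\<in>S. count_list xs s) \<le> card S * (e - 1)"
          using sum_bounded_above[of S "count_list xs" "e - 1"] by simp
        moreover have "length xs = (\<Sum>s\<in>S. count_list xs s)"
          using less.prems S by (intro sum_count_set[symmetric]) auto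
        ultimately show False using False by simp
      qed
      then obtain s where s: "s \<in> S" "e \<le> count_list xs s" by blast
      from collect[OF s(1) less.prems s(2)] obtain ys where
        ys: "ys \<in> lists S" "length ys + e = length xs" "listprod G xs = s [^] e \<otimes> listprod G ys"
        by blast
      then have "set ys \<subseteq> carrier G" using S by auto
      then have "listprod G xs = listprod G ys" using ys(3) e(2)[OF s(1)] by simp
      then show ?thesis using less.hyps[of ys] ys e(1) by auto
    qed (use less.prems in auto)
  qed
  have "\<exists>xs\<in>lists S. x = listprod G xs" if "x \<in> generate G S" for x
    using that
  proof (induction rule: generate.induct)
    case one
    show ?case by (intro bexI[of _ "[]"]) auto
  next
    case (incl h)
    then show ?case using S by (intro bexI[of _ "[h]"]) auto
  next
    case (inv h)
    then have h: "h \<in> carrier G" using S by auto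
    have "h [^] (e - 1) \<otimes> h = \<one>" using e(2)[OF inv] e(1) h by (metis Suc_diff_1 nat_pow_Suc)
    then have "inv h = h [^] (e - 1)" using h by (intro inv_equality) auto
    then show ?case using inv h
      by (intro bexI[of _ "replicate (e - 1) h"]) (auto simp: listprod_replicate)
  next
    case (eng h1 h2)
    then obtain xs ys where xs: "xs \<in> lists S" "h1 = listprod G xs" "ys \<in> lists S" "h2 = listprod G ys"
      by blast
    then have "h1 \<otimes> h2 = listprod G (xs @ ys)" using S listprod_append[of xs ys] by fastforce
    with xs show ?case by (intro bexI[of _ "xs @ ys"]) auto
  qed
  with short have "generate G S \<subseteq> listprod G ` ?L" by fastforce
  moreover have "finite ?L" by (rule finite_lists_length_le[OF S(1)])
  ultimately show ?thesis by (meson finite_imageI finite_subset)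
qed

end


text \<open>A Sylow subgroup \<open>P\<close> together with the central kernel generates \<open>G\<close>, so \<open>P\<close> is normal and
  contains every element of \<open>p\<close>-power order.\<close>

lemma (in group_hom) p_group_of_central_kernel:
  fixes e :: nat
  assumes p: "prime p" and H: "finite_p_group p H" and fin: "finite (carrier G)"
    and central: "\<And>z t. \<lbrakk>z \<in> kernel G H h; t \<in> carrier G\<rbrakk> \<Longrightarrow> z \<otimes> t = t \<otimes> z"
    and S: "S \<subseteq> carrier G" "generate G S = carrier G"
    and tors: "\<And>s. s \<in> S \<Longrightarrow> s [^] (p ^ e) = \<one>"
  shows "finite_p_group p G"
proof -
  have "order G \<noteq> 0" using fin G.order_gt_0_iff_finite by blast
  then obtain a m where am: "order G = p ^ a * m" "\<not> p dvd m"
    using multiplicity_decompose'[of "order G" p] p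
    by (metis not_prime_unit)
  from sylow_thm[OF p G.group_axioms am(1) fin] obtain P where
    P: "subgroup P G" "card P = p ^ a" by blast
  interpret P: subgroup P G by fact
  let ?Z = "kernel G H h"
  have Z: "?Z \<lhd> G" by (rule normal_kernel)
  let ?K = "?Z <#> P"
  have K: "subgroup ?K G" by (rule G.mult_norm_subgroup[OF Z P(1)])
  have Zc: "z \<in> carrier G" if "z \<in> ?Z" for z using that by (simp add: kernel_def)
  have KI: "z \<otimes> x \<in> ?K" if "z \<in> ?Z" "x \<in> P" for z x
    using that unfolding set_mult_def by blast
  have ZK: "?Z \<subseteq> ?K" using KI[OF _ P.one_closed] Zc by (metis G.r_one subsetI)
  have "\<one> \<in> ?Z" by (simp add: kernel_def)
  then have PK: "P \<subseteq> ?K" using KI P.mem_carrier by (metis G.l_one subsetI)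
  have div: "card A dvd card B" if "subgroup A G" "subgroup B G" "A \<subseteq> B" for A B
  proof -
    have "card (rcosets\<^bsub>G\<lparr>carrier := B\<rparr>\<^esub> A) * card A = card B"
      using group.lagrange[OF G.subgroup_imp_group[OF that(2)] G.subgroup_incl[OF that]]
      by (simp add: order_def)
    then show ?thesis by (metis dvd_triv_right)
  qed
  obtain j where j: "card ?K = card ?Z * j"
    using div[OF normal.axioms(1)[OF Z] K ZK] by (auto elim: dvdE)
  obtain l where l: "card ?K = p ^ a * l"
    using div[OF P(1) K PK] P(2) by (auto elim: dvdE)
  \<comment> \<open>The index \<open>i\<close> of \<open>?K\<close> divides the index of the kernel,
    a power of \<open>p\<close> because the quotient embeds in \<open>H\<close>. It also divides
    \<open>m\<close>, which is prime to \<open>p\<close>, so \<open>i = 1\<close>.\<close>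
  obtain i where i: "order G = card ?K * i"
    using G.lagrange[OF K] by (metis mult.commute)
  let ?I = "H\<lparr>carrier := h ` carrier G\<rparr>"
  have I: "group_hom G ?I h"
    using H.subgroup_imp_group[OF img_is_subgroup] homh
    by (auto simp: group_hom_def group_hom_axioms_def hom_def)
  have "kernel G ?I h = ?Z" by (simp add: kernel_def)
  then have "bij_betw (\<lambda>X. the_elem (h ` X)) (rcosets ?Z) (h ` carrier G)"
    using group_hom.FactGroup_iso_set[OF I] by (simp add: iso_def FactGroup_def)
  then have "card (rcosets ?Z) = card (h ` carrier G)" by (rule bij_betw_same_card)
  moreover have "card (h ` carrier G) dvd order H"
    using H.lagrange[OF img_is_subgroup] by (metis dvd_triv_right)
  moreover obtain c where "order H = p ^ c" using H by (auto simp: finite_p_group_def)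
  ultimately have "card (rcosets ?Z) dvd p ^ c" by simp
  moreover have "card (rcosets ?Z) = j * i"
  proof -
    have "card (rcosets ?Z) * card ?Z = j * i * card ?Z"
      using G.lagrange[OF normal.axioms(1)[OF Z]] i j by (simp add: ac_simps)
    moreover have "card ?Z \<noteq> 0" using j i \<open>order G \<noteq> 0\<close> by (metis mult_0)
    ultimately show ?thesis by simp
  qed
  ultimately have "i dvd p ^ c" by (metis dvd_mult_right)
  moreover have "m = l * i" using am i l p by (auto simp: ac_simps)
  then have "coprime i (p ^ c)"
    using am(2) p by (metis coprime_commute coprime_power_right_iff dvd_mult prime_imp_coprime)
  ultimately have "i = 1" by (metis coprime_absorb_left nat_dvd_1_iff_1)
  then have "card ?K = card (carrier G)" using i by (simp add: order_def)
  then have KG: "?K = carrier G"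
    using fin K by (metis card_subset_eq subgroup.subset)
  have "P \<lhd> G"
  proof (rule G.normal_invI[OF P(1)])
    fix t x assume t: "t \<in> carrier G" and x: "x \<in> P"
    then obtain z y where zy: "z \<in> ?Z" "y \<in> P" "t = z \<otimes> y" using KG by (force simp: set_mult_def)
    have zc: "z \<in> carrier G" using zy by (simp add: kernel_def)
    have "t \<otimes> x \<otimes> inv t = z \<otimes> (y \<otimes> x \<otimes> inv y) \<otimes> inv z"
      using zy x zc by (simp add: G.m_assoc G.inv_mult_group)
    also have "\<dots> = y \<otimes> x \<otimes> inv y"
      using central[OF zy(1), of "y \<otimes> x \<otimes> inv y"] zy x zc by (simp add: G.m_assoc)
    finally show "t \<otimes> x \<otimes> inv t \<in> P" using zy x by simp
  qed
  then interpret P: normal P G .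
  have "s \<in> P" if s: "s \<in> S" for s
  proof -
    have sc: "s \<in> carrier G" using s S by auto
    interpret Q: group "G Mod P" by (rule P.factorgroup_is_group)
    have "order (G Mod P) = m"
      using G.lagrange[OF P(1)] am P(2) p by (simp add: order_def FactGroup_def)
    then have "P #> (s [^] m) = P"
      using Q.pow_order_eq_1[of "P #> s"] sc by (simp add: carrier_FactGroup P.FactGroup_pow)
    then have sm: "s [^] m \<in> P" using G.rcos_self[OF _ P(1), of "s [^] m"] sc by simp
    \<comment> \<open>By Bezout, \<open>s\<close> is a product of powers of \<open>s [^] m\<close>,
      which lies in \<open>P\<close>, and of \<open>s [^] (p ^ e)\<close>, which is 1.\<close>
    have "coprime (int m) (int (p ^ e))"
      using am(2) p by (metis coprime_commute coprime_int_iff coprime_power_right_iff prime_imp_coprime)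
    then obtain u v where "u * int m + v * int (p ^ e) = 1"
      by (metis bezout_int coprime_imp_gcd_eq_1)
    then have "s = s [^] (int m * u + int (p ^ e) * v)" using sc by (simp add: mult.commute G.int_pow_1)
    also have "\<dots> = (s [^] m) [^] u \<otimes> (s [^] (p ^ e)) [^] v"
      using sc by (simp add: G.int_pow_mult G.int_pow_pow flip: int_pow_int)
    also have "\<dots> = (s [^] m) [^] u" using tors[OF s] sc by simp
    finally show ?thesis using G.subgroup_int_pow_closed[OF P(1) sm] by metis
  qed
  then have "carrier G \<subseteq> P" using G.generate_subgroup_incl[OF _ P(1)] S by blast
  then have "order G = p ^ a" using P(2) P.subset by (simp add: order_def subset_antisym)
  then show ?thesis using fin G.group_axioms by (auto simp: finite_p_group_def)
qed


section \<open>Calculus in the tensor product modulo q\<close>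

text \<open>The power of \<open>v\<close> ending factor i cancels the one opening factor i + 1,
  leaving \<open>v\<close> to the powers -q and q - k around the partial product \<open>P k\<close>
  = v s_1 ... s_(k-1). At k = q the right-hand power is trivial. The correction product in the
  relation for {kk'} takes this shape in both places where it has to be evaluated,
  \<open>ac_br_eq\<close> and \<open>pairing_bdry\<close>.\<close>

lemma (in group) listprod_telescope:
  fixes s P :: "nat \<Rightarrow> 'a"
  assumes v: "v \<in> carrier G" and s: "\<And>i. s i \<in> carrier G" and Pc: "\<And>i. P i \<in> carrier G"
    and P: "P 1 = v" "\<And>k. k \<ge> 1 \<Longrightarrow> P (Suc k) = P k \<otimes> s k" and "k \<ge> 1"
  shows "listprod G (map (\<lambda>i. v [^] (int i - int q) \<otimes> s i \<otimes> v [^] (int q - int i - 1)) [1..<k]) =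
    v [^] (- int q) \<otimes> P k \<otimes> v [^] (int q - int k)"
  using \<open>k \<ge> 1\<close>
proof (induction k rule: nat_induct_at_least)
  case base
  have "v [^] (- int q) \<otimes> v \<otimes> v [^] (int q - 1) = v [^] (- int q + 1 + (int q - 1))"
    using v by (simp only: int_pow_mult int_pow_1)
  then show ?case using P v by simp
next
  case (Suc k)
  let ?f = "\<lambda>i. v [^] (int i - int q) \<otimes> s i \<otimes> v [^] (int q - int i - 1)"
  have fc: "set (map ?f [1..<k]) \<subseteq> carrier G" using v s by auto
  have "listprod G (map ?f [1..<Suc k]) = listprod G (map ?f [1..<k]) \<otimes> ?f k"
    using listprod_append[OF fc, of "[?f k]"] Suc.hyps v s by simp
  also have "\<dots> = v [^] (- int q) \<otimes> P k \<otimes> (v [^] (int q - int k) \<otimes> v [^] (int k - int q)) \<otimes> s k \<otimes>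
      v [^] (int q - int k - 1)"
    unfolding Suc.IH using v s Pc by (simp add: m_assoc)
  also have "v [^] (int q - int k) \<otimes> v [^] (int k - int q) = \<one>"
    using v by (simp flip: int_pow_mult)
  also have "v [^] (- int q) \<otimes> P k \<otimes> \<one> \<otimes> s k \<otimes> v [^] (int q - int k - 1) =
      v [^] (- int q) \<otimes> P (Suc k) \<otimes> v [^] (int q - int (Suc k))"
    using v s Pc P(2)[OF Suc.hyps] by (simp add: m_assoc algebra_simps)
  finally show ?case .
qed

lemma (in group) int_pow_commute:
  assumes "a \<in> carrier G" "b \<in> carrier G" "a \<otimes> b = b \<otimes> a"
  shows "a [^] (i::int) \<otimes> b = b \<otimes> a [^] i"
proof -
  have nat: "a [^] (n::nat) \<otimes> b = b \<otimes> a [^] n" for n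
  proof (induction n)
    case (Suc n)
    have "a [^] n \<otimes> (a \<otimes> b) = b \<otimes> a [^] n \<otimes> a"
      using assms Suc by (simp flip: m_assoc)
    then show ?case using assms by (simp add: m_assoc)
  qed (use assms in simp)
  show ?thesis
  proof (cases i)
    case (nonneg n)
    then show ?thesis using nat by (simp add: int_pow_int)
  next
    case (neg n)
    have "inv (a [^] Suc n) \<otimes> (b \<otimes> a [^] Suc n) \<otimes> inv (a [^] Suc n) = b \<otimes> inv (a [^] Suc n)"
      unfolding nat[symmetric] using assms by (simp add: inv_mult_cancel del: nat_pow_Suc)
    then have "inv (a [^] Suc n) \<otimes> b = b \<otimes> inv (a [^] Suc n)"
      using assms by (simp add: m_assoc del: nat_pow_Suc)
    then show ?thesis using assms unfolding neg by (simp only: int_pow_neg_int)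
  qed
qed

text \<open>The relations of \<open>M \<otimes>\<^sup>q G\<close>, where the second crossed module is the identity of \<open>G\<close>, so that the
  fibre product is a copy of \<open>M\<close>.\<close>

locale tensor_calculus = A: aut_action T G ac + B: aut_action M G am
  for T (structure) and M and G and ac and am +
  fixes mu and tn and br and bd and q :: nat
  assumes mu_hom: "mu \<in> hom M G"
    and mu_am: "\<lbrakk>g \<in> carrier G; m \<in> carrier M\<rbrakk> \<Longrightarrow> mu (am g m) = g \<otimes>\<^bsub>G\<^esub> mu m \<otimes>\<^bsub>G\<^esub> inv\<^bsub>G\<^esub> g"
    and am_mu: "\<lbrakk>m \<in> carrier M; m' \<in> carrier M\<rbrakk> \<Longrightarrow> am (mu m) m' = m \<otimes>\<^bsub>M\<^esub> m' \<otimes>\<^bsub>M\<^esub> inv\<^bsub>M\<^esub> m"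
    and tn_closed [simp, intro]: "\<lbrakk>m \<in> carrier M; n \<in> carrier G\<rbrakk> \<Longrightarrow> tn m n \<in> carrier T"
    and br_closed [simp, intro]: "m \<in> carrier M \<Longrightarrow> br m \<in> carrier T"
    and gens: "generate T ({tn m n | m n. m \<in> carrier M \<and> n \<in> carrier G} \<union> br ` carrier M) = carrier T"
    and ac_tn: "\<lbrakk>g \<in> carrier G; m \<in> carrier M; n \<in> carrier G\<rbrakk> \<Longrightarrow>
      ac g (tn m n) = tn (am g m) (g \<otimes>\<^bsub>G\<^esub> n \<otimes>\<^bsub>G\<^esub> inv\<^bsub>G\<^esub> g)"
    and ac_br: "\<lbrakk>g \<in> carrier G; m \<in> carrier M\<rbrakk> \<Longrightarrow> ac g (br m) = br (am g m)"
    and bd_hom: "bd \<in> hom T G"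
    and bd_tn: "\<lbrakk>m \<in> carrier M; n \<in> carrier G\<rbrakk> \<Longrightarrow>
      bd (tn m n) = mu m \<otimes>\<^bsub>G\<^esub> n \<otimes>\<^bsub>G\<^esub> inv\<^bsub>G\<^esub> mu m \<otimes>\<^bsub>G\<^esub> inv\<^bsub>G\<^esub> n"
    and bd_br: "m \<in> carrier M \<Longrightarrow> bd (br m) = mu m [^]\<^bsub>G\<^esub> q"
    and tn_mult_right: "\<lbrakk>m \<in> carrier M; n \<in> carrier G; n' \<in> carrier G\<rbrakk> \<Longrightarrow>
      tn m (n \<otimes>\<^bsub>G\<^esub> n') = tn m n \<otimes> ac n (tn m n')"
    and tn_mult_left: "\<lbrakk>m \<in> carrier M; m' \<in> carrier M; n \<in> carrier G\<rbrakk> \<Longrightarrow>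
      tn (m \<otimes>\<^bsub>M\<^esub> m') n = ac (mu m) (tn m' n) \<otimes> tn m n"
    and br_conj: "\<lbrakk>k \<in> carrier M; m \<in> carrier M; n \<in> carrier G\<rbrakk> \<Longrightarrow>
      br k \<otimes> tn m n \<otimes> inv br k = ac (mu k [^]\<^bsub>G\<^esub> q) (tn m n)"
    and br_mult: "\<lbrakk>k \<in> carrier M; k' \<in> carrier M\<rbrakk> \<Longrightarrow>
      br (k \<otimes>\<^bsub>M\<^esub> k') = br k \<otimes>
        listprod T (map (\<lambda>i. tn (inv\<^bsub>M\<^esub> k)
          ((mu k [^]\<^bsub>G\<^esub> (1 - int q + int i) \<otimes>\<^bsub>G\<^esub> mu k' \<otimes>\<^bsub>G\<^esub>
            inv\<^bsub>G\<^esub> (mu k [^]\<^bsub>G\<^esub> (1 - int q + int i))) [^]\<^bsub>G\<^esub> i)) [1..<q]) \<otimes> br k'"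
    and br_comm: "\<lbrakk>k \<in> carrier M; k' \<in> carrier M\<rbrakk> \<Longrightarrow>
      br k \<otimes> br k' \<otimes> inv br k \<otimes> inv br k' = tn (k [^]\<^bsub>M\<^esub> q) (mu k' [^]\<^bsub>G\<^esub> q)"
    and br_tn: "\<lbrakk>m \<in> carrier M; n \<in> carrier G\<rbrakk> \<Longrightarrow>
      br (m \<otimes>\<^bsub>M\<^esub> am n (inv\<^bsub>M\<^esub> m)) = tn m n [^] q"
    and odd_q: "odd q"
begin

sublocale mu: group_hom M G mu
  by (simp add: group_hom_def group_hom_axioms_def mu_hom B.T.group_axioms A.G.group_axioms)

sublocale bd: group_hom T G bd
  by (simp add: group_hom_def group_hom_axioms_def bd_hom A.T.group_axioms A.G.group_axioms)

lemma tn_one_left: "n \<in> carrier G \<Longrightarrow> tn \<one>\<^bsub>M\<^esub> n = \<one>"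
  using tn_mult_left[of "\<one>\<^bsub>M\<^esub>" "\<one>\<^bsub>M\<^esub>" n] by (simp add: A.ac_one)

lemma tn_one_right: "m \<in> carrier M \<Longrightarrow> tn m \<one>\<^bsub>G\<^esub> = \<one>"
  using tn_mult_right[of m "\<one>\<^bsub>G\<^esub>" "\<one>\<^bsub>G\<^esub>"] by (simp add: A.ac_one)

lemma tn_inv_left:
  assumes "m \<in> carrier M" "n \<in> carrier G"
  shows "tn (inv\<^bsub>M\<^esub> m) n = inv (ac (inv\<^bsub>G\<^esub> (mu m)) (tn m n))"
proof -
  have "\<one> = ac (inv\<^bsub>G\<^esub> (mu m)) (tn m n) \<otimes> tn (inv\<^bsub>M\<^esub> m) n"
    using tn_mult_left[of "inv\<^bsub>M\<^esub> m" m n] assms by (simp add: tn_one_left)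
  then show ?thesis using assms by (metis A.ac_closed A.G.inv_closed A.T.inv_equality A.T.inv_inv
        B.T.inv_closed mu.hom_closed A.T.inv_closed tn_closed)
qed

lemma tn_inv_right:
  assumes "m \<in> carrier M" "n \<in> carrier G"
  shows "tn m (inv\<^bsub>G\<^esub> n) = inv (ac (inv\<^bsub>G\<^esub> n) (tn m n))"
proof -
  have "\<one> = tn m (inv\<^bsub>G\<^esub> n) \<otimes> ac (inv\<^bsub>G\<^esub> n) (tn m n)"
    using tn_mult_right[of m "inv\<^bsub>G\<^esub> n" n] assms by (simp add: tn_one_right)
  then show ?thesis using assms by (metis A.ac_closed A.G.inv_closed A.T.inv_equality tn_closed)
qed

text \<open>Expand \<open>mm' \<otimes> nn'\<close> in the two possible orders.\<close>

lemma tn_conj_tn: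
  assumes m: "m \<in> carrier M" "m' \<in> carrier M" and n: "n \<in> carrier G" "n' \<in> carrier G"
  shows "tn m n \<otimes> tn m' n' \<otimes> inv (tn m n) = ac (bd (tn m n)) (tn m' n')"
proof -
  have key: "ac (mu m \<otimes>\<^bsub>G\<^esub> n) (tn a b) \<otimes> tn m n = tn m n \<otimes> ac (n \<otimes>\<^bsub>G\<^esub> mu m) (tn a b)"
    if a: "a \<in> carrier M" and b: "b \<in> carrier G" for a b
  proof -
    let ?x = "ac (mu m) (tn a n)" and ?z = "ac n (tn m b)"
    let ?l = "ac (mu m \<otimes>\<^bsub>G\<^esub> n) (tn a b)" and ?r = "ac (n \<otimes>\<^bsub>G\<^esub> mu m) (tn a b)"
    note c = a b m(1) n(1)
    have "tn (m \<otimes>\<^bsub>M\<^esub> a) (n \<otimes>\<^bsub>G\<^esub> b) = ac (mu m) (tn a (n \<otimes>\<^bsub>G\<^esub> b)) \<otimes> tn m (n \<otimes>\<^bsub>G\<^esub> b)"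
      using c by (simp add: tn_mult_left)
    then have "?x \<otimes> ?l \<otimes> tn m n \<otimes> ?z = tn (m \<otimes>\<^bsub>M\<^esub> a) (n \<otimes>\<^bsub>G\<^esub> b)"
      using c by (simp add: tn_mult_right A.ac_distrib A.ac_mult A.T.m_assoc)
    also have "\<dots> = ?x \<otimes> tn m n \<otimes> ?r \<otimes> ?z"
      using c by (simp add: tn_mult_right[of _ n b] tn_mult_left A.ac_distrib A.ac_mult A.T.m_assoc)
    finally have "(?x \<otimes> (?l \<otimes> tn m n)) \<otimes> ?z = (?x \<otimes> (tn m n \<otimes> ?r)) \<otimes> ?z"
      using c by (simp add: A.T.m_assoc)
    then show ?thesis using c by (simp del: A.T.m_assoc)
  qed
  \<comment> \<open>Chosen so that \<open>key\<close>, applied to the translate of m' \<otimes> n'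
    by \<open>?k\<close>, has m' \<otimes> n' itself on the right; on the left the acting element
    becomes \<mu>(m) n \<mu>(m)^-1 n^-1, the boundary of m \<otimes> n.\<close>
  let ?k = "inv\<^bsub>G\<^esub> (n \<otimes>\<^bsub>G\<^esub> mu m)"
  have k: "?k \<in> carrier G" using m n by simp
  have "ac ?k (tn m' n') = tn (am ?k m') (?k \<otimes>\<^bsub>G\<^esub> n' \<otimes>\<^bsub>G\<^esub> inv\<^bsub>G\<^esub> ?k)"
    by (rule ac_tn[OF k m(2) n(2)])
  then have "ac (mu m \<otimes>\<^bsub>G\<^esub> n) (ac ?k (tn m' n')) \<otimes> tn m n =
      tn m n \<otimes> ac (n \<otimes>\<^bsub>G\<^esub> mu m) (ac ?k (tn m' n'))"
    using key[of "am ?k m'" "?k \<otimes>\<^bsub>G\<^esub> n' \<otimes>\<^bsub>G\<^esub> inv\<^bsub>G\<^esub> ?k"] k m n by simp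
  also have "ac (n \<otimes>\<^bsub>G\<^esub> mu m) (ac ?k (tn m' n')) = tn m' n'" using m n by simp
  also have "ac (mu m \<otimes>\<^bsub>G\<^esub> n) (ac ?k (tn m' n')) = ac (bd (tn m n)) (tn m' n')"
    using m n by (simp add: bd_tn A.G.inv_mult_group A.G.m_assoc flip: A.ac_mult)
  finally show ?thesis using m n by (simp add: bd_tn A.T.inv_solve_right')
qed

text \<open>For fixed s both sides are homomorphisms in t, and then both sides are actions in s, so
  the identity passes from \<open>S\<close> to the subgroup it generates. \<open>S\<close> is kept
  arbitrary because the identity is first used for the subgroup generated by tensors alone.\<close>

lemma peiffer_generate:
  assumes S: "S \<subseteq> carrier T" "\<And>s t. \<lbrakk>s \<in> S; t \<in> S\<rbrakk> \<Longrightarrow> s \<otimes> t \<otimes> inv s = ac (bd s) t"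
    and s: "s \<in> generate T S" and t: "t \<in> generate T S"
  shows "s \<otimes> t \<otimes> inv s = ac (bd s) t"
proof -
  have Sc: "x \<in> carrier T" if "x \<in> generate T S" for x
    using A.T.generate_in_carrier[OF S(1) that] .
  have 1: "s \<otimes> t \<otimes> inv s = ac (bd s) t" if s: "s \<in> S" and t: "t \<in> generate T S" for s t
    using t
  proof (induction t rule: generate.induct)
    case (inv t)
    then have c: "s \<in> carrier T" "t \<in> carrier T" using S s by auto
    then have "s \<otimes> inv t \<otimes> inv s = inv (s \<otimes> t \<otimes> inv s)"
      by (simp add: A.T.inv_mult_group A.T.m_assoc)
    then show ?case using c S(2)[OF s inv] by (simp add: A.ac_inv)
  next
    case (eng t t')
    have c: "s \<in> carrier T" "t \<in> carrier T" "t' \<in> carrier T" using s S Sc eng by auto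
    then have "s \<otimes> (t \<otimes> t') \<otimes> inv s = (s \<otimes> t \<otimes> inv s) \<otimes> (s \<otimes> t' \<otimes> inv s)"
      by (simp add: A.T.m_assoc A.T.inv_mult_cancel)
    then show ?case using c eng by (simp add: A.ac_distrib)
  qed (use S s in \<open>auto simp: subset_iff\<close>)
  show ?thesis
    using s t
  proof (induction s arbitrary: t rule: generate.induct)
    case one
    then show ?case using Sc by (simp add: A.ac_one)
  next
    case (incl s)
    then show ?case by (rule 1)
  next
    case (inv s)
    have c: "s \<in> carrier T" "t \<in> carrier T" using inv S Sc by auto
    \<comment> \<open>The identity for \<open>s\<close> is applied to this conjugate, which the
      action of \<open>bd s\<close> therefore sends to \<open>t\<close>.\<close>
    have "inv s \<otimes> t \<otimes> s \<in> generate T S"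
      using inv by (intro generate.eng[OF generate.eng[OF generate.inv] generate.incl])
    then have "s \<otimes> (inv s \<otimes> t \<otimes> s) \<otimes> inv s = ac (bd s) (inv s \<otimes> t \<otimes> s)"
      using 1[OF inv(1)] by blast
    then have "t = ac (bd s) (inv s \<otimes> t \<otimes> s)"
      using c by (simp add: A.T.m_assoc A.T.inv_mult_cancel)
    then have "ac (inv\<^bsub>G\<^esub> (bd s)) t = inv s \<otimes> t \<otimes> s"
      using c A.ac_cancel(1)[of "bd s" "inv s \<otimes> t \<otimes> s"] by simp
    then show ?case using c by simp
  next
    case (eng s s')
    have c: "s \<in> carrier T" "s' \<in> carrier T" "t \<in> carrier T" using eng Sc by auto
    have "s' \<otimes> t \<otimes> inv s' \<in> generate T S"
      using A.T.generate_m_inv_closed[OF S(1) eng.hyps(2)] eng by (intro generate.eng)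
    then have "s \<otimes> (s' \<otimes> t \<otimes> inv s') \<otimes> inv s = ac (bd s) (ac (bd s') t)"
      using eng by simp
    then show ?case using c by (simp add: A.ac_mult A.T.inv_mult_group A.T.m_assoc)
  qed
qed

text \<open>This links displacements in \<open>M\<close> with displacements in \<open>T\<close>.
  After expanding the left factor, everything reduces to the two expansions of m \<otimes> yg, where
  yg is also read as g(g^-1 y g).\<close>

lemma tn_displacement:
  assumes m: "m \<in> carrier M" and g: "g \<in> carrier G" and y: "y \<in> carrier G"
  shows "tn (m \<otimes>\<^bsub>M\<^esub> am g (inv\<^bsub>M\<^esub> m)) y = tn m g \<otimes> inv (ac y (tn m g))"
proof -
  let ?u = "tn m g" and ?y' = "inv\<^bsub>G\<^esub> g \<otimes>\<^bsub>G\<^esub> y \<otimes>\<^bsub>G\<^esub> g"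
  have "tn (am g (inv\<^bsub>M\<^esub> m)) y = ac g (tn (inv\<^bsub>M\<^esub> m) ?y')"
    using assms by (simp add: ac_tn A.G.m_assoc A.G.inv_mult_cancel)
  also have "\<dots> = inv (ac (g \<otimes>\<^bsub>G\<^esub> inv\<^bsub>G\<^esub> (mu m)) (tn m ?y'))"
    using assms by (simp add: tn_inv_left A.ac_inv A.ac_mult)
  finally have "ac (mu m) (tn (am g (inv\<^bsub>M\<^esub> m)) y) =
      inv (ac (mu m \<otimes>\<^bsub>G\<^esub> (g \<otimes>\<^bsub>G\<^esub> inv\<^bsub>G\<^esub> (mu m))) (tn m ?y'))"
    using assms by (simp add: A.ac_inv A.ac_mult)
  also have "ac (mu m \<otimes>\<^bsub>G\<^esub> (g \<otimes>\<^bsub>G\<^esub> inv\<^bsub>G\<^esub> (mu m))) (tn m ?y') = ac (bd ?u) (ac g (tn m ?y'))"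
    using assms by (simp add: bd_tn A.G.m_assoc A.G.inv_mult_cancel flip: A.ac_mult)
  also have "\<dots> = ?u \<otimes> ac g (tn m ?y') \<otimes> inv ?u"
    using assms tn_conj_tn[of m "am g m" g "g \<otimes>\<^bsub>G\<^esub> ?y' \<otimes>\<^bsub>G\<^esub> inv\<^bsub>G\<^esub> g"] by (simp add: ac_tn)
  finally have "tn (m \<otimes>\<^bsub>M\<^esub> am g (inv\<^bsub>M\<^esub> m)) y = inv (?u \<otimes> ac g (tn m ?y') \<otimes> inv ?u) \<otimes> tn m y"
    using assms by (simp add: tn_mult_left)
  moreover have "?u \<otimes> ac g (tn m ?y') = tn m y \<otimes> ac y ?u"
    using assms tn_mult_right[of m g ?y'] tn_mult_right[of m y g]
    by (simp add: A.G.m_assoc A.G.inv_mult_cancel)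
  ultimately show ?thesis
    using assms by (simp add: A.T.inv_mult_group A.T.m_assoc)
qed

text \<open>The counterpart of \<open>tn_displacement\<close> for the second factor, needed when
  tensors conjugate braces. The essential term comes from expanding am = m(m^-1 a m) in the first
  factor in both ways; \<open>?a\<close> is m^-1 a m, which the action of m takes back to a.\<close>

lemma tn_commutator:
  assumes a: "a \<in> carrier M" and m: "m \<in> carrier M" and n: "n \<in> carrier G"
  shows "tn a (bd (tn m n)) = ac (mu a) (tn m n) \<otimes> inv (tn m n)"
proof -
  let ?t = "tn m n" and ?n = "mu m \<otimes>\<^bsub>G\<^esub> n \<otimes>\<^bsub>G\<^esub> inv\<^bsub>G\<^esub> mu m"
    and ?a = "inv\<^bsub>M\<^esub> m \<otimes>\<^bsub>M\<^esub> a \<otimes>\<^bsub>M\<^esub> m"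
  note c = a m n
  have "tn a (bd ?t) = tn a ?n \<otimes> ac ?n (tn a (inv\<^bsub>G\<^esub> n))"
    using c by (simp add: bd_tn tn_mult_right)
  also have "ac ?n (tn a (inv\<^bsub>G\<^esub> n)) = inv (ac (bd ?t) (tn a n))"
    using c by (simp add: bd_tn tn_inv_right A.ac_inv A.ac_mult)
  also have "\<dots> = inv (?t \<otimes> tn a n \<otimes> inv ?t)"
    using c by (simp add: tn_conj_tn)
  finally have 1: "tn a (bd ?t) = tn a ?n \<otimes> inv (?t \<otimes> tn a n \<otimes> inv ?t)" .
  have "am (mu m) ?a = a"
    using c by (simp add: am_mu B.T.m_assoc B.T.inv_mult_cancel)
  then have "tn a ?n = ac (mu m) (tn ?a n)" using c by (simp add: ac_tn)
  then have "tn a ?n \<otimes> ?t = tn (m \<otimes>\<^bsub>M\<^esub> ?a) n" using c by (simp add: tn_mult_left)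
  also have "m \<otimes>\<^bsub>M\<^esub> ?a = a \<otimes>\<^bsub>M\<^esub> m" using c by (simp add: B.T.m_assoc B.T.inv_mult_cancel)
  also have "tn (a \<otimes>\<^bsub>M\<^esub> m) n = ac (mu a) ?t \<otimes> tn a n" using c by (simp add: tn_mult_left)
  finally have "tn a ?n \<otimes> ?t \<otimes> inv (tn a n) = ac (mu a) ?t"
    using c by (simp add: A.T.m_assoc)
  then show ?thesis
    unfolding 1 using c by (simp add: A.T.inv_mult_group flip: A.T.m_assoc)
qed

section \<open>Powers and translates of braces\<close>

lemma br_one: "br \<one>\<^bsub>M\<^esub> = \<one>"
proof -
  have "(mu \<one>\<^bsub>M\<^esub> [^]\<^bsub>G\<^esub> i \<otimes>\<^bsub>G\<^esub> mu \<one>\<^bsub>M\<^esub> \<otimes>\<^bsub>G\<^esub> inv\<^bsub>G\<^esub> (mu \<one>\<^bsub>M\<^esub> [^]\<^bsub>G\<^esub> i)) [^]\<^bsub>G\<^esub> (j::nat) = \<one>\<^bsub>G\<^esub>" for i :: int and j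
    by simp
  moreover have "listprod T (map (\<lambda>i. \<one>) xs) = \<one>" for xs :: "nat list"
    by (induction xs) auto
  ultimately have "br \<one>\<^bsub>M\<^esub> = br \<one>\<^bsub>M\<^esub> \<otimes> br \<one>\<^bsub>M\<^esub>"
    using br_mult[of "\<one>\<^bsub>M\<^esub>" "\<one>\<^bsub>M\<^esub>"] by (simp add: tn_one_right del: mu.hom_one)
  then show ?thesis by simp
qed

text \<open>For commuting \<open>a\<close> and \<open>b\<close> the correction term in \<open>br_mult\<close> is the power with exponent
  \<open>1 + \<dots> + (q - 1)\<close> of \<open>c = a\<^sup>-\<^sup>1 \<otimes> \<mu>(b)\<close>; since \<open>c\<^sup>q = {1}\<close> and \<open>q\<close> is odd, it vanishes.\<close>

lemma br_mult_commuting: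
  assumes a: "a \<in> carrier M" and b: "b \<in> carrier M" and ab: "a \<otimes>\<^bsub>M\<^esub> b = b \<otimes>\<^bsub>M\<^esub> a"
  shows "br (a \<otimes>\<^bsub>M\<^esub> b) = br a \<otimes> br b"
proof -
  let ?c = "tn (inv\<^bsub>M\<^esub> a) (mu b)"
  have c: "?c \<in> carrier T" using a b by simp
  have ia: "b \<otimes>\<^bsub>M\<^esub> inv\<^bsub>M\<^esub> a = inv\<^bsub>M\<^esub> a \<otimes>\<^bsub>M\<^esub> b"
    using a b ab by (metis B.T.inv_closed B.T.inv_solve_left' B.T.inv_solve_right B.T.m_assoc B.T.m_closed)
  have fix_b: "ac (mu b) ?c = ?c"
    using a b ia by (simp add: ac_tn am_mu B.T.m_assoc A.G.m_assoc)
  \<comment> \<open>Since \<mu>(b) fixes \<open>?c\<close>, the crossed multiplicativity in the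
    second factor becomes plain multiplicativity on the powers of \<mu>(b).\<close>
  have pow: "tn (inv\<^bsub>M\<^esub> a) (mu b [^]\<^bsub>G\<^esub> i) = ?c [^] i" for i :: nat
  proof (induction i)
    case 0
    show ?case using a by (simp add: tn_one_right)
  next
    case (Suc i)
    have "ac (mu b [^]\<^bsub>G\<^esub> j) ?c = ?c" for j :: nat
      by (induction j) (use a b fix_b in \<open>auto simp: A.ac_one A.ac_mult\<close>)
    then show ?case using a b Suc by (simp add: tn_mult_right)
  qed
  have "mu a \<otimes>\<^bsub>G\<^esub> mu b = mu b \<otimes>\<^bsub>G\<^esub> mu a" using ab a b by (metis mu.hom_mult)
  then have "mu a [^]\<^bsub>G\<^esub> i \<otimes>\<^bsub>G\<^esub> mu b = mu b \<otimes>\<^bsub>G\<^esub> mu a [^]\<^bsub>G\<^esub> i" for i :: int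
    using a b by (intro A.G.int_pow_commute) auto
  then have conj: "mu a [^]\<^bsub>G\<^esub> i \<otimes>\<^bsub>G\<^esub> mu b \<otimes>\<^bsub>G\<^esub> inv\<^bsub>G\<^esub> (mu a [^]\<^bsub>G\<^esub> i) = mu b" for i :: int
    using a b by (simp add: A.G.m_assoc)
  have "br (inv\<^bsub>M\<^esub> a \<otimes>\<^bsub>M\<^esub> am (mu b) (inv\<^bsub>M\<^esub> (inv\<^bsub>M\<^esub> a))) = ?c [^] q"
    using a b by (intro br_tn) auto
  moreover have "inv\<^bsub>M\<^esub> a \<otimes>\<^bsub>M\<^esub> am (mu b) (inv\<^bsub>M\<^esub> (inv\<^bsub>M\<^esub> a)) = \<one>\<^bsub>M\<^esub>"
    using a b by (simp add: am_mu B.T.m_assoc B.T.inv_mult_cancel flip: ab)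
  ultimately have cq: "?c [^] q = \<one>" by (simp add: br_one)
  have lp: "listprod T (map (\<lambda>i. ?c [^] i) xs) = ?c [^] sum_list xs" for xs :: "nat list"
    by (induction xs) (use c in \<open>auto simp: A.T.nat_pow_mult\<close>)
  have "q dvd \<Sum>{1..<q}"
  proof -
    obtain r where r: "q = Suc (2 * r)" using odd_q by (auto elim: oddE)
    have "\<Sum>{1..<q} = r * q"
      unfolding r by (induction r) auto
    then show ?thesis by simp
  qed
  then obtain j where "sum_list [1..<q] = q * j"
    using interv_sum_list_conv_sum_set_nat[of "\<lambda>x. x" 1 q] by (auto elim: dvdE)
  then have "?c [^] sum_list [1..<q] = \<one>"
    using c cq by (simp flip: A.T.nat_pow_pow)
  then have "listprod T (map (\<lambda>i. ?c [^] i) [1..<q]) = \<one>" by (simp add: lp)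
  then show ?thesis using br_mult[OF a b] a b by (simp add: conj pow)
qed

lemma br_pow: "m \<in> carrier M \<Longrightarrow> br (m [^]\<^bsub>M\<^esub> (i::nat)) = br m [^] i"
proof (induction i)
  case (Suc i)
  then show ?case
    using B.T.nat_pow_Suc2[of m i] A.T.nat_pow_Suc2[of "br m" i] by (simp add: br_mult_commuting)
qed (simp add: br_one)

text \<open>Write ^g m = xm and let v be the inverse of u = m \<otimes> g. Since x^-1 = m(^g m^-1),
  \<open>br_tn\<close> gives {x^-1} = u^q and so {x} = v^q. Each factor of the correction product in
  \<open>br_mult\<close> has x^-1 on the left, hence is a displacement of u by
  \<open>tn_displacement\<close>. The product telescopes to v^-q times the inverse of m^q \<otimes>
  g, and the powers of v cancel.\<close>

lemma ac_br_eq: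
  assumes m: "m \<in> carrier M" and g: "g \<in> carrier G"
  shows "ac g (br m) = inv (tn (m [^]\<^bsub>M\<^esub> q) g) \<otimes> br m"
proof -
  let ?S = "{tn m n | m n. m \<in> carrier M \<and> n \<in> carrier G}"
  have pf: "s \<otimes> t \<otimes> inv s = ac (bd s) t" if "s \<in> generate T ?S" "t \<in> generate T ?S" for s t
    by (rule peiffer_generate[OF _ _ that]) (auto simp: tn_conj_tn)
  have S_mem: "tn a b \<in> generate T ?S" if "a \<in> carrier M" "b \<in> carrier G" for a b
    by (rule generate.incl) (use that in blast)
  define u where "u = tn m g"
  define v where "v = inv u"
  define x where "x = am g m \<otimes>\<^bsub>M\<^esub> inv\<^bsub>M\<^esub> m"
  \<comment> \<open>By \<open>tn_mult_left\<close> these are the partial products v s_1 ... s_(k-1)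
    of the elements defined next, as \<open>listprod_telescope\<close> requires; the case k = q is
    the tensor in the claim.\<close>
  define P where "P k = inv (tn (m [^]\<^bsub>M\<^esub> k) g)" for k :: nat
  define s where "s i = ac (mu m [^]\<^bsub>G\<^esub> i) v" for i :: nat
  have c: "u \<in> carrier T" "v \<in> carrier T" "x \<in> carrier M" "P k \<in> carrier T" "s k \<in> carrier T" for k
    using m g by (auto simp: u_def v_def x_def P_def s_def)
  have ix: "inv\<^bsub>M\<^esub> x = m \<otimes>\<^bsub>M\<^esub> am g (inv\<^bsub>M\<^esub> m)"
    using m g by (simp add: x_def B.ac_inv B.T.inv_mult_group)
  have bdv: "bd v = mu x"
    using m g by (simp add: v_def u_def bd_tn x_def mu_am A.G.inv_mult_group A.G.m_assoc)
  have uS: "u \<in> generate T ?S" unfolding u_def using m g by (rule S_mem)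
  then have vS: "v \<in> generate T ?S"
    unfolding v_def by (intro A.T.generate_m_inv_closed) auto
  have sub: "subgroup (generate T ?S) T" by (rule A.T.generate_is_subgroup) auto
  \<comment> \<open>Since \<open>bd v = mu x\<close>, powers of \<mu>(x) act on the subgroup of
    tensors as conjugation by powers of \<open>v\<close>.\<close>
  have ac_v: "ac (mu x [^]\<^bsub>G\<^esub> j) t = v [^] j \<otimes> t \<otimes> inv (v [^] j)" if "t \<in> generate T ?S" for t and j :: int
    using pf[OF A.T.subgroup_int_pow_closed[OF sub vS] that, of j] c by (simp add: bdv bd.hom_int_pow)
  have sS: "s i \<in> generate T ?S" for i
  proof -
    have "inv (s i) \<in> generate T ?S"
      using m g by (simp add: s_def v_def u_def A.ac_inv ac_tn S_mem)
    then show ?thesis using A.T.generate_m_inv_closed[of ?S "inv (s i)"] c by auto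
  qed
  have P1: "P 1 = v" using m by (simp add: P_def v_def u_def)
  have PS: "P (Suc k) = P k \<otimes> s k" for k
    using m g by (simp add: P_def s_def v_def u_def tn_mult_left A.T.inv_mult_group A.ac_inv mu.hom_nat_pow)
  have tm: "tn (inv\<^bsub>M\<^esub> x) ((mu x [^]\<^bsub>G\<^esub> (1 - int q + int i) \<otimes>\<^bsub>G\<^esub> mu m \<otimes>\<^bsub>G\<^esub>
            inv\<^bsub>G\<^esub> (mu x [^]\<^bsub>G\<^esub> (1 - int q + int i))) [^]\<^bsub>G\<^esub> i) =
      v [^] (int i - int q) \<otimes> s i \<otimes> v [^] (int q - int i - 1)" for i
  proof -
    let ?j = "1 - int q + int i"
    let ?h = "mu x [^]\<^bsub>G\<^esub> ?j"
    have h: "?h \<in> carrier G" using c by simp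
    have "(?h \<otimes>\<^bsub>G\<^esub> mu m \<otimes>\<^bsub>G\<^esub> inv\<^bsub>G\<^esub> ?h) [^]\<^bsub>G\<^esub> k = ?h \<otimes>\<^bsub>G\<^esub> mu m [^]\<^bsub>G\<^esub> k \<otimes>\<^bsub>G\<^esub> inv\<^bsub>G\<^esub> ?h" for k :: nat
      by (induction k) (use h m in \<open>auto simp: A.G.m_assoc A.G.inv_mult_cancel\<close>)
    then have "tn (inv\<^bsub>M\<^esub> x) ((?h \<otimes>\<^bsub>G\<^esub> mu m \<otimes>\<^bsub>G\<^esub> inv\<^bsub>G\<^esub> ?h) [^]\<^bsub>G\<^esub> i) =
        u \<otimes> inv (ac (?h \<otimes>\<^bsub>G\<^esub> mu m [^]\<^bsub>G\<^esub> i \<otimes>\<^bsub>G\<^esub> inv\<^bsub>G\<^esub> ?h) u)"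
      using m g h by (simp add: ix tn_displacement u_def)
    also have "inv (ac (?h \<otimes>\<^bsub>G\<^esub> mu m [^]\<^bsub>G\<^esub> i \<otimes>\<^bsub>G\<^esub> inv\<^bsub>G\<^esub> ?h) u) = ac ?h (ac (mu m [^]\<^bsub>G\<^esub> i) (ac (inv\<^bsub>G\<^esub> ?h) v))"
      using m h c by (simp add: v_def A.ac_mult A.ac_inv)
    \<comment> \<open>The inner conjugating power drops out because \<open>v\<close> commutes with
      its own powers.\<close>
    also have "ac (inv\<^bsub>G\<^esub> ?h) v = v"
    proof -
      have "ac (mu x [^]\<^bsub>G\<^esub> (- ?j)) v = v"
        unfolding ac_v[OF vS] using c A.T.int_pow_commute[of v v "- ?j"] by (simp add: A.T.m_assoc)
      then show ?thesis using c by (simp add: A.G.int_pow_neg del: minus_add_distrib minus_diff_eq)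
    qed
    also have "ac ?h (ac (mu m [^]\<^bsub>G\<^esub> i) v) = v [^] ?j \<otimes> s i \<otimes> inv (v [^] ?j)"
      using ac_v[OF sS] by (simp add: s_def)
    also have "u \<otimes> (v [^] ?j \<otimes> s i \<otimes> inv (v [^] ?j)) = (v [^] (- 1 :: int) \<otimes> v [^] ?j) \<otimes> s i \<otimes> v [^] (- ?j)"
      using c by (simp add: A.T.int_pow_neg v_def A.T.m_assoc del: minus_add_distrib minus_diff_eq)
    also have "v [^] (- 1 :: int) \<otimes> v [^] ?j = v [^] (int i - int q)"
      using c by (simp flip: A.T.int_pow_mult)
    finally show ?thesis by (simp add: algebra_simps)
  qed
  have q1: "q \<ge> 1" using odd_q by (cases q) auto
  have "br (inv\<^bsub>M\<^esub> x) = u [^] q" using m g by (simp add: ix u_def br_tn)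
  moreover have "br (inv\<^bsub>M\<^esub> x) \<otimes> br x = \<one>"
    using br_mult_commuting[of "inv\<^bsub>M\<^esub> x" x] c by (simp add: br_one)
  ultimately have "br x = inv (u [^] q)"
    using c by (metis A.T.inv_equality A.T.inv_inv A.T.nat_pow_closed br_closed A.T.inv_closed)
  then have brx: "br x = v [^] int q" using c by (simp add: v_def A.T.nat_pow_inv int_pow_int)
  have "ac g (br m) = br (x \<otimes>\<^bsub>M\<^esub> m)" using m g by (simp add: ac_br x_def B.T.m_assoc)
  also have "\<dots> = v [^] int q \<otimes> (v [^] (- int q) \<otimes> P q \<otimes> v [^] (int q - int q)) \<otimes> br m"
    unfolding br_mult[OF c(3) m] tm brx A.T.listprod_telescope[where s = s and P = P, OF c(2) c(5) c(4) P1 PS q1] ..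
  also have "\<dots> = P q \<otimes> br m"
    using c m by (simp add: A.T.int_pow_neg A.T.m_assoc A.T.inv_mult_cancel)
  finally show ?thesis by (simp add: P_def)
qed

text \<open>Four cases on generators. Tensor on tensor is \<open>tn_conj_tn\<close>, and brace on
  tensor is the relation \<open>br_conj\<close>. In the other two, \<open>ac_br_eq\<close> rewrites
  the translated brace: for a tensor acting, \<open>tn_commutator\<close> and \<open>br_conj\<close>
  finish; for a brace acting, the relation \<open>br_comm\<close> does.\<close>

theorem peiffer:
  assumes "s \<in> carrier T" "t \<in> carrier T"
  shows "s \<otimes> t \<otimes> inv s = ac (bd s) t"
proof (rule peiffer_generate)
  let ?S = "{tn m n | m n. m \<in> carrier M \<and> n \<in> carrier G} \<union> br ` carrier M"
  show "?S \<subseteq> carrier T" by auto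
  show "s \<in> generate T ?S" "t \<in> generate T ?S" using assms gens by auto
  have tb: "tn m n \<otimes> br k \<otimes> inv (tn m n) = ac (bd (tn m n)) (br k)"
    if "m \<in> carrier M" "n \<in> carrier G" "k \<in> carrier M" for m n k
  proof -
    have "ac (bd (tn m n)) (br k) = inv (tn (k [^]\<^bsub>M\<^esub> q) (bd (tn m n))) \<otimes> br k"
      using that by (simp add: ac_br_eq)
    also have "tn (k [^]\<^bsub>M\<^esub> q) (bd (tn m n)) = (br k \<otimes> tn m n \<otimes> inv (br k)) \<otimes> inv (tn m n)"
      using that by (simp add: tn_commutator mu.hom_nat_pow br_conj)
    finally show ?thesis using that by (simp add: A.T.inv_mult_group A.T.m_assoc)
  qed
  have bb: "br k \<otimes> br k' \<otimes> inv (br k) = ac (bd (br k)) (br k')"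
    if "k \<in> carrier M" "k' \<in> carrier M" for k k'
  proof -
    have "ac (bd (br k)) (br k') = inv (tn (k' [^]\<^bsub>M\<^esub> q) (mu k [^]\<^bsub>G\<^esub> q)) \<otimes> br k'"
      using that by (simp add: ac_br_eq bd_br)
    also have "\<dots> = inv (br k' \<otimes> br k \<otimes> inv br k' \<otimes> inv br k) \<otimes> br k'"
      using that by (simp add: br_comm)
    finally show ?thesis using that by (simp add: A.T.inv_mult_group A.T.m_assoc)
  qed
  show "s \<otimes> t \<otimes> inv s = ac (bd s) t" if "s \<in> ?S" "t \<in> ?S" for s t
    using that tn_conj_tn tb bb br_conj by (auto simp: bd_br)
qed

lemma bd_ac:
  assumes g: "g \<in> carrier G" and t: "t \<in> carrier T"
  shows "bd (ac g t) = g \<otimes>\<^bsub>G\<^esub> bd t \<otimes>\<^bsub>G\<^esub> inv\<^bsub>G\<^esub> g"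
proof -
  let ?S = "{tn m n | m n. m \<in> carrier M \<and> n \<in> carrier G} \<union> br ` carrier M"
  have "t \<in> generate T ?S" using t gens by simp
  have cp: "(g \<otimes>\<^bsub>G\<^esub> (a \<otimes>\<^bsub>G\<^esub> inv\<^bsub>G\<^esub> g)) [^]\<^bsub>G\<^esub> k = g \<otimes>\<^bsub>G\<^esub> (a [^]\<^bsub>G\<^esub> k \<otimes>\<^bsub>G\<^esub> inv\<^bsub>G\<^esub> g)" if "a \<in> carrier G" for a and k :: nat
    by (induction k) (use that g in \<open>auto simp: A.G.m_assoc A.G.inv_mult_cancel\<close>)
  have gen: "bd (ac g s) = g \<otimes>\<^bsub>G\<^esub> bd s \<otimes>\<^bsub>G\<^esub> inv\<^bsub>G\<^esub> g" if "s \<in> ?S" for s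
    using that g by (auto simp: ac_tn ac_br bd_tn bd_br mu_am cp A.G.inv_mult_group A.G.m_assoc A.G.inv_mult_cancel)
  have Sc: "?S \<subseteq> carrier T" by auto
  show ?thesis
    using \<open>t \<in> generate T ?S\<close>
  proof (induction t rule: generate.induct)
    case one
    then show ?case using g by simp
  next
    case (incl s)
    then show ?case by (rule gen)
  next
    case (inv s)
    then have "s \<in> carrier T" using Sc by blast
    then show ?case using gen[OF inv] g by (simp add: A.ac_inv A.G.inv_mult_group A.G.m_assoc)
  next
    case (eng s t)
    then have "s \<in> carrier T" "t \<in> carrier T" using gens by auto
    then show ?case using eng g by (simp add: A.ac_distrib A.G.m_assoc A.G.inv_mult_cancel)
  qed
qed

end


section \<open>Finiteness and powerfulness\<close>

abbreviation pow_subgroup :: "nat \<Rightarrow> ('a, 'b) monoid_scheme \<Rightarrow> 'a set" where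
  "pow_subgroup p G \<equiv> generate G {x [^]\<^bsub>G\<^esub> p | x. x \<in> carrier G}"

lemma (in group) subgroup_pow_subgroup: "subgroup (pow_subgroup p G) G"
  by (rule generate_is_subgroup) auto

lemma (in group_hom) hom_pow_subgroup:
  assumes "x \<in> pow_subgroup p G"
  shows "h x \<in> pow_subgroup p H"
proof -
  have "h ` {x [^] p | x. x \<in> carrier G} \<subseteq> {x [^]\<^bsub>H\<^esub> p | x. x \<in> carrier H}"
    by (auto simp: hom_nat_pow)
  moreover have "h ` pow_subgroup p G = generate H (h ` {x [^] p | x. x \<in> carrier G})"
    by (rule generate_img[symmetric]) auto
  ultimately show ?thesis using assms H.mono_generate by blast
qed

context tensor_calculus
begin

theorem finite_p_group_tensor:
  assumes q: "prime q" and M: "finite_p_group q M" and G: "finite_p_group q G"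
  shows "finite_p_group q T"
proof -
  define S where "S = {tn m n | m n. m \<in> carrier M \<and> n \<in> carrier G} \<union> br ` carrier M"
  have fin: "finite (carrier M)" "finite (carrier G)" using M G by (auto simp: finite_p_group_def)
  obtain a where a: "order M = q ^ a" using M by (auto simp: finite_p_group_def)
  have "{tn m n | m n. m \<in> carrier M \<and> n \<in> carrier G} = (\<lambda>(m, n). tn m n) ` (carrier M \<times> carrier G)"
    by auto
  then have S: "finite S" "S \<subseteq> carrier T" "generate T S = carrier T"
    using fin gens unfolding S_def by auto
  have conj: "t \<otimes> s \<otimes> inv t \<in> S" if "s \<in> S" "t \<in> carrier T" for s t
  proof -
    have "s \<in> carrier T" using that S by auto
    then have "t \<otimes> s \<otimes> inv t = ac (bd t) s" using that by (simp add: peiffer)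
    moreover have "ac (bd t) s \<in> S"
      using that unfolding S_def by (fastforce simp: ac_tn ac_br)
    ultimately show ?thesis by simp
  qed
  have tb: "br m [^] (q ^ a) = \<one>" if "m \<in> carrier M" for m
    using br_pow[OF that, of "q ^ a"] B.T.pow_order_eq_1[OF that] by (simp add: a br_one)
  \<comment> \<open>The extra factor \<open>q\<close> is the power at which the tensor becomes a
    brace, by \<open>br_tn\<close>.\<close>
  have "tn m n [^] (q * q ^ a) = \<one>" if "m \<in> carrier M" "n \<in> carrier G" for m n
  proof -
    have "(tn m n [^] q) [^] (q ^ a) = \<one>"
      using br_tn[OF that] tb[of "m \<otimes>\<^bsub>M\<^esub> am n (inv\<^bsub>M\<^esub> m)"] that by simp
    then show ?thesis using that by (simp add: A.T.nat_pow_pow)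
  qed
  moreover have "br m [^] (q * q ^ a) = \<one>" if "m \<in> carrier M" for m
  proof -
    have "(br m [^] (q ^ a)) [^] q = \<one>" using tb[OF that] by simp
    then show ?thesis using that by (simp add: A.T.nat_pow_pow mult.commute)
  qed
  ultimately have tors: "s [^] (q ^ Suc a) = \<one>" if "s \<in> S" for s
    using that by (auto simp: S_def)
  have "finite (carrier T)"
    using A.T.finite_generate_torsion[OF S(1,2) conj _ tors] prime_gt_0_nat[OF q] S(3) by simp
  moreover have "z \<otimes> t = t \<otimes> z" if "z \<in> kernel T G bd" "t \<in> carrier T" for z t
  proof -
    have "z \<in> carrier T" "z \<otimes> t \<otimes> inv z = t"
      using that peiffer[of z t] by (auto simp: kernel_def A.ac_one)
    then show ?thesis using that by (metis A.T.inv_solve_right' A.T.m_closed)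
  qed
  ultimately show ?thesis
    using bd.p_group_of_central_kernel[OF q G _ _ S(2,3) tors] by blast
qed

text \<open>Modulo \<open>B\<close> the element \<open>c = \<^sup>m(m \<otimes> y) (m \<otimes> y)\<^sup>-\<^sup>1\<close> is central and fixed by \<open>G\<close>, so that
  \<open>m\<^sup>q \<otimes> y\<close> becomes \<open>c\<close> to the power \<open>q(q-1)/2\<close> times \<open>(m \<otimes> y)\<^sup>q\<close>, a product of \<open>q\<close>-th powers.\<close>

lemma tn_pow_mem:
  assumes B: "B \<lhd> T" "pow_subgroup q T \<subseteq> B"
    and BB: "\<And>g h t. \<lbrakk>g \<in> carrier G; h \<in> carrier G; t \<in> carrier T\<rbrakk> \<Longrightarrow>
          ac h (ac g t \<otimes> inv t) \<otimes> inv (ac g t \<otimes> inv t) \<in> B"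
    and m: "m \<in> carrier M" and y: "y \<in> carrier G"
  shows "tn (m [^]\<^bsub>M\<^esub> q) y \<in> B"
proof -
  interpret B: normal B T by fact
  interpret Q: group "T Mod B" by (rule B.factorgroup_is_group)
  define \<pi> where "\<pi> t = B #> t" for t
  have \<pi>_hom: "\<pi> \<in> hom T (T Mod B)" unfolding \<pi>_def by (rule B.r_coset_hom_Mod)
  interpret \<pi>: group_hom T "T Mod B" \<pi>
    by (simp add: group_hom_def group_hom_axioms_def \<pi>_hom A.T.group_axioms Q.group_axioms)
  have \<pi>_one: "\<pi> t = \<one>\<^bsub>T Mod B\<^esub> \<longleftrightarrow> t \<in> B" if "t \<in> carrier T" for t
    using that A.T.rcos_self[OF that B.is_subgroup] A.T.coset_join2[OF that B.is_subgroup]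
    by (auto simp: \<pi>_def)
  have \<pi>_eq: "\<pi> s = \<pi> t" if "s \<otimes> inv t \<in> B" "s \<in> carrier T" "t \<in> carrier T" for s t
  proof -
    have "\<pi> (s \<otimes> inv t) \<otimes>\<^bsub>T Mod B\<^esub> \<pi> t = \<pi> t"
      using that \<pi>_one[of "s \<otimes> inv t"] by (simp del: mult_FactGroup one_FactGroup \<pi>.hom_mult)
    moreover have "\<pi> (s \<otimes> inv t) \<otimes>\<^bsub>T Mod B\<^esub> \<pi> t = \<pi> (s \<otimes> inv t \<otimes> t)"
      using that by (intro \<pi>.hom_mult[symmetric]) auto
    ultimately show ?thesis using that by (simp add: A.T.m_assoc)
  qed
  define u where "u = tn m y"
  define c where "c = ac (mu m) u \<otimes> inv u"
  define U where "U = \<pi> u"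
  define C where "C = \<pi> c"
  note [simp del] = mult_FactGroup one_FactGroup
  have cl [simp]: "u \<in> carrier T" "c \<in> carrier T" "U \<in> carrier (T Mod B)" "C \<in> carrier (T Mod B)"
    using m y by (auto simp: u_def c_def U_def C_def)
  \<comment> \<open>\<open>c\<close> is itself a displacement, so \<open>BB\<close> says that
    \<open>G\<close> fixes it modulo \<open>B\<close>.\<close>
  have \<pi>c: "\<pi> (ac h c) = C" if h: "h \<in> carrier G" for h
    unfolding C_def by (rule \<pi>_eq) (use h m BB[OF _ h cl(1), of "mu m"] in \<open>auto simp: c_def\<close>)
  \<comment> \<open>Conjugation by \<open>u\<close> is the action of \<open>bd u\<close>, which
    fixes \<open>c\<close> modulo \<open>B\<close>.\<close>
  have CU: "C \<otimes>\<^bsub>T Mod B\<^esub> U = U \<otimes>\<^bsub>T Mod B\<^esub> C"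
  proof -
    have "ac (bd u) c \<otimes> u = u \<otimes> c" by (simp add: A.T.m_assoc flip: peiffer)
    then have "\<pi> (ac (bd u) c) \<otimes>\<^bsub>T Mod B\<^esub> \<pi> u = \<pi> u \<otimes>\<^bsub>T Mod B\<^esub> \<pi> c"
      by (simp flip: \<pi>.hom_mult)
    then show ?thesis by (simp add: \<pi>c U_def C_def)
  qed
  have comm: "U \<otimes>\<^bsub>T Mod B\<^esub> C [^]\<^bsub>T Mod B\<^esub> k = C [^]\<^bsub>T Mod B\<^esub> k \<otimes>\<^bsub>T Mod B\<^esub> U" for k :: nat
    using Q.int_pow_commute[of C U "int k"] CU by (simp add: int_pow_int)
  have 1: "\<pi> (ac (mu m [^]\<^bsub>G\<^esub> k) u) = C [^]\<^bsub>T Mod B\<^esub> k \<otimes>\<^bsub>T Mod B\<^esub> U" for k :: nat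
  proof (induction k)
    case (Suc k)
    have "ac (mu m [^]\<^bsub>G\<^esub> Suc k) u = ac (mu m [^]\<^bsub>G\<^esub> k) (c \<otimes> u)"
      using m by (simp add: c_def A.ac_mult A.T.m_assoc)
    then have "\<pi> (ac (mu m [^]\<^bsub>G\<^esub> Suc k) u) = C \<otimes>\<^bsub>T Mod B\<^esub> (C [^]\<^bsub>T Mod B\<^esub> k \<otimes>\<^bsub>T Mod B\<^esub> U)"
      using m by (simp add: A.ac_distrib \<pi>c Suc del: A.G.nat_pow_Suc)
    then show ?case using Q.nat_pow_Suc2[of C k] by (simp add: Q.m_assoc)
  qed (simp add: U_def A.ac_one)
  \<comment> \<open>Peeling off one factor m contributes the translate of \<open>u\<close> by the
    kth power of \<mu>(m), which is C^k U in the quotient. This is the origin of the exponent 0 + 1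
    + ... + (k - 1).\<close>
  have pow: "\<pi> (tn (m [^]\<^bsub>M\<^esub> k) y) = C [^]\<^bsub>T Mod B\<^esub> (\<Sum>{..<k}) \<otimes>\<^bsub>T Mod B\<^esub> U [^]\<^bsub>T Mod B\<^esub> k" for k :: nat
  proof (induction k)
    case 0
    show ?case using y by (simp add: tn_one_left)
  next
    case (Suc k)
    have "tn (m [^]\<^bsub>M\<^esub> Suc k) y = ac (mu m [^]\<^bsub>G\<^esub> k) u \<otimes> tn (m [^]\<^bsub>M\<^esub> k) y"
      using m y by (simp add: tn_mult_left u_def mu.hom_nat_pow)
    then have "\<pi> (tn (m [^]\<^bsub>M\<^esub> Suc k) y) = C [^]\<^bsub>T Mod B\<^esub> k \<otimes>\<^bsub>T Mod B\<^esub>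
        (U \<otimes>\<^bsub>T Mod B\<^esub> C [^]\<^bsub>T Mod B\<^esub> (\<Sum>{..<k})) \<otimes>\<^bsub>T Mod B\<^esub> U [^]\<^bsub>T Mod B\<^esub> k"
      using m y by (simp add: 1 Suc Q.m_assoc del: B.T.nat_pow_Suc)
    also have "\<dots> = (C [^]\<^bsub>T Mod B\<^esub> k \<otimes>\<^bsub>T Mod B\<^esub> C [^]\<^bsub>T Mod B\<^esub> (\<Sum>{..<k})) \<otimes>\<^bsub>T Mod B\<^esub>
        (U \<otimes>\<^bsub>T Mod B\<^esub> U [^]\<^bsub>T Mod B\<^esub> k)"
      unfolding comm by (simp add: Q.m_assoc)
    finally show ?case using Q.nat_pow_Suc2[of U k] by (simp add: Q.nat_pow_mult add.commute)
  qed
  obtain r where r: "q = Suc (2 * r)" using odd_q by (auto elim: oddE)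
  \<comment> \<open>Here oddness enters: the exponent is a multiple of \<open>q\<close>, so this
    power of \<open>C\<close> is the image of a qth power in \<open>T\<close>.\<close>
  have sum: "\<Sum>{..<q} = r * q" unfolding r by (induction r) auto
  have triv: "X [^]\<^bsub>T Mod B\<^esub> q = \<one>\<^bsub>T Mod B\<^esub>" if "X = \<pi> x" "x \<in> carrier T" for X x
  proof -
    have "x [^] q \<in> pow_subgroup q T" using that by (intro generate.incl) auto
    then show ?thesis using that B(2) \<pi>_one[of "x [^] q"] by (auto simp: \<pi>.hom_nat_pow)
  qed
  have "(C [^]\<^bsub>T Mod B\<^esub> r) [^]\<^bsub>T Mod B\<^esub> q = \<one>\<^bsub>T Mod B\<^esub>"
    by (rule triv[of _ "c [^] r"]) (simp_all add: C_def \<pi>.hom_nat_pow)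
  then have "\<pi> (tn (m [^]\<^bsub>M\<^esub> q) y) = \<one>\<^bsub>T Mod B\<^esub>"
    using triv[OF U_def] by (simp add: pow sum Q.nat_pow_pow)
  then show ?thesis using m y by (simp add: \<pi>_one)
qed

theorem powerful_action_tensor:
  assumes q: "prime q" and M: "finite_p_group q M" and G: "finite_p_group q G"
    and pw: "\<And>g m. \<lbrakk>g \<in> carrier G; m \<in> carrier M\<rbrakk> \<Longrightarrow> am g m \<otimes>\<^bsub>M\<^esub> inv\<^bsub>M\<^esub> m \<in> pow_subgroup q M"
    and gt: "g \<in> carrier G" "t \<in> carrier T"
  shows "ac g t \<otimes> inv t \<in> pow_subgroup q T"
proof (rule A.commutators_in_subgroup[OF q G finite_p_group_tensor[OF q M G] _ A.T.subgroup_pow_subgroup _ _ gt])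
  show inner: "\<exists>g\<in>carrier G. \<forall>s\<in>carrier T. ac g s = t \<otimes> s \<otimes> inv t" if "t \<in> carrier T" for t
    using that by (intro bexI[of _ "bd t"]) (auto simp: peiffer)
  show "A.invariant (pow_subgroup q T)"
    unfolding A.invariant_def using group_hom.hom_pow_subgroup[OF A.ac_group_hom] by blast
  fix B assume B: "subgroup B T" "A.invariant B" "pow_subgroup q T \<subseteq> B"
    and BB: "\<And>g h t. \<lbrakk>g \<in> carrier G; h \<in> carrier G; t \<in> carrier T\<rbrakk> \<Longrightarrow>
          ac h (ac g t \<otimes> inv t) \<otimes> inv (ac g t \<otimes> inv t) \<in> B"
  interpret B: subgroup B T by fact
  have Bn: "B \<lhd> T"
  proof (rule A.T.normal_invI[OF B(1)])
    fix t b assume "t \<in> carrier T" "b \<in> B"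
    then show "t \<otimes> b \<otimes> inv t \<in> B"
      using peiffer[of t b] B(2) B.mem_carrier unfolding A.invariant_def by fastforce
  qed
  \<comment> \<open>\<open>L\<close> is a subgroup because \<open>B\<close> is invariant. It
    contains all qth powers by \<open>tn_pow_mem\<close>, hence M^q, and therefore by
    \<open>pw\<close> every displacement in \<open>M\<close>.\<close>
  define L where "L = {m \<in> carrier M. \<forall>y\<in>carrier G. tn m y \<in> B}"
  have Bac: "ac g b \<in> B" if "g \<in> carrier G" "b \<in> B" for g b
    using B(2) that unfolding A.invariant_def by blast
  have "subgroup L M"
  proof (rule B.T.subgroupI)
    show "L \<noteq> {}" using tn_one_left by (auto simp: L_def intro!: exI[of _ "\<one>\<^bsub>M\<^esub>"])
    show "inv\<^bsub>M\<^esub> m \<in> L" if "m \<in> L" for m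
      using that Bac by (simp add: L_def tn_inv_left)
    show "m \<otimes>\<^bsub>M\<^esub> m' \<in> L" if "m \<in> L" "m' \<in> L" for m m'
      using that Bac by (simp add: L_def tn_mult_left)
  qed (auto simp: L_def)
  moreover have "{x [^]\<^bsub>M\<^esub> q | x. x \<in> carrier M} \<subseteq> L"
    using tn_pow_mem[OF Bn B(3) BB] by (auto simp: L_def)
  ultimately have L: "pow_subgroup q M \<subseteq> L" by (rule B.T.generate_subgroup_incl[rotated])
  \<comment> \<open>By \<open>fixed_mod_subgroup\<close> this is a subgroup, so it is enough to
    place the generators in it; for tensors, \<open>tn_displacement\<close> turns the claim into
    membership in \<open>L\<close>.\<close>
  let ?F = "{b \<in> carrier T. \<forall>g\<in>carrier G. ac g b \<otimes> inv b \<in> B}"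
  have "tn m n \<in> ?F" if m: "m \<in> carrier M" and n: "n \<in> carrier G" for m n
  proof -
    have "ac g (tn m n) \<otimes> inv (tn m n) \<in> B" if g: "g \<in> carrier G" for g
    proof -
      have "inv\<^bsub>M\<^esub> (am n m \<otimes>\<^bsub>M\<^esub> inv\<^bsub>M\<^esub> m) \<in> pow_subgroup q M"
        using pw[OF n m] by (intro B.T.generate_m_inv_closed) auto
      then have "m \<otimes>\<^bsub>M\<^esub> am n (inv\<^bsub>M\<^esub> m) \<in> L"
        using L m n by (auto simp: B.T.inv_mult_group B.ac_inv)
      then have "tn m n \<otimes> inv (ac g (tn m n)) \<in> B"
        using g m n by (auto simp: L_def simp flip: tn_displacement)
      then have "inv (tn m n \<otimes> inv (ac g (tn m n))) \<in> B" by simp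
      then show ?thesis using g m n by (simp add: A.T.inv_mult_group)
    qed
    then show ?thesis using m n by simp
  qed
  \<comment> \<open>By \<open>ac_br_eq\<close> the displacement of a brace is exactly the inverse of
    m^q \<otimes> g.\<close>
  moreover have "br m \<in> ?F" if m: "m \<in> carrier M" for m
    using m tn_pow_mem[OF Bn B(3) BB m] by (simp add: ac_br_eq A.T.m_assoc)
  ultimately have "generate T ({tn m n | m n. m \<in> carrier M \<and> n \<in> carrier G} \<union> br ` carrier M) \<subseteq> ?F"
    by (intro A.T.generate_subgroup_incl[OF _ A.fixed_mod_subgroup[OF A.T.subgroup_self Bn]]) auto
  then show "\<forall>g\<in>carrier G. \<forall>t\<in>carrier T. ac g t \<otimes> inv t \<in> B" unfolding gens by auto
qed

end


section \<open>Homomorphisms out of the tensor product\<close>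

text \<open>The universal property of a presentation is used at the level of words: if the values
  respect the relations, evaluation is constant on the class of any word in the generators
  (\<open>eval_word_cong\<close>).\<close>

definition eval_word :: "('a, 'b) monoid_scheme \<Rightarrow> ('x \<Rightarrow> 'a) \<Rightarrow> 'x word \<Rightarrow> 'a" where
  "eval_word H f w = listprod H (map (\<lambda>(b, x). if b then f x else inv\<^bsub>H\<^esub> (f x)) w)"

lemma eval_word_simps [simp]:
  "eval_word H f [] = \<one>\<^bsub>H\<^esub>"
  "eval_word H f ((b, x) # w) = (if b then f x else inv\<^bsub>H\<^esub> (f x)) \<otimes>\<^bsub>H\<^esub> eval_word H f w"
  by (simp_all add: eval_word_def)

lemma words_append [simp]: "u @ v \<in> words X \<longleftrightarrow> u \<in> words X \<and> v \<in> words X"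
  by (auto simp: words_def)

lemma words_Nil [simp]: "[] \<in> words X"
  by (simp add: words_def)

lemma words_Cons [simp]: "(b, x) # w \<in> words X \<longleftrightarrow> x \<in> X \<and> w \<in> words X"
  by (auto simp: words_def)

lemma concat_replicate_singleton: "concat (replicate n [x]) = replicate n x"
  by (induction n) auto

context group
begin

lemma eval_word_closed [simp]: "\<lbrakk>f \<in> X \<rightarrow> carrier G; w \<in> words X\<rbrakk> \<Longrightarrow> eval_word G f w \<in> carrier G"
  by (induction w) (auto simp: Pi_iff)

lemma eval_word_append:
  "\<lbrakk>f \<in> X \<rightarrow> carrier G; u \<in> words X; v \<in> words X\<rbrakk> \<Longrightarrow>
    eval_word G f (u @ v) = eval_word G f u \<otimes> eval_word G f v"
  by (induction u) (auto simp: m_assoc Pi_iff)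

lemma eval_word_letters: "eval_word G f (map (\<lambda>i. (True, h i)) xs) = listprod G (map (\<lambda>i. f (h i)) xs)"
  by (induction xs) auto

text \<open>A congruence class of a word in the generators contains only such words; this matters
  because \<open>word_cong\<close> is reflexive on all words.\<close>

lemma eval_word_cong:
  assumes R: "R \<subseteq> words X \<times> words X" and f: "f \<in> X \<rightarrow> carrier G"
    and eq: "\<And>u v. (u, v) \<in> R \<Longrightarrow> eval_word G f u = eval_word G f v"
    and "(u, v) \<in> word_cong X R"
  shows "(u \<in> words X \<longleftrightarrow> v \<in> words X) \<and> (u \<in> words X \<longrightarrow> eval_word G f u = eval_word G f v)"
  using assms(4)
proof (induction rule: word_cong.induct)
  case (append u u' v v')
  then show ?case using f by (auto simp: eval_word_append)
next
  case (cancel x b)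
  then have "f x \<in> carrier G" using f by auto
  then show ?case using cancel by auto
next
  case (rel u v)
  then show ?case using R eq by blast
qed auto

end

lemma id_xmod_simps [simp]:
  "src (id_xmod G) = G" "tgt (id_xmod G) = G" "bdry (id_xmod G) g = g"
  "act (id_xmod G) g x = g \<otimes>\<^bsub>G\<^esub> x \<otimes>\<^bsub>G\<^esub> inv\<^bsub>G\<^esub> g"
  by (simp_all add: id_xmod_def)

section \<open>The presented group and its universal property\<close>

locale xmod_tensor =
  fixes q :: nat and X :: "('m, 'g) xmod"
  assumes crossed: "crossed_module X"
begin

abbreviation "M \<equiv> src X"
abbreviation "G \<equiv> tgt X"
abbreviation "\<mu> \<equiv> bdry X"
abbreviation "Y \<equiv> id_xmod G"
abbreviation "gens \<equiv> tensor_gens X Y"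
abbreviation "rels \<equiv> tensor_rels q X Y"
abbreviation "T \<equiv> tensor_group q X Y"
abbreviation "cls w \<equiv> word_cong gens rels `` {w}"
abbreviation "tn m n \<equiv> cls (letter (Tensor m n))"
abbreviation "br m \<equiv> cls (letter (Brace (m, \<mu> m)))"

sublocale A: aut_action M G "act X"
  using crossed
  by (auto simp: crossed_module_def aut_action_def aut_action_axioms_def iso_def)

sublocale mu: group_hom M G \<mu>
  using crossed
  by (auto simp: crossed_module_def group_hom_def group_hom_axioms_def)

sublocale T: group T
  unfolding tensor_group_def by (rule group_presented_group)

lemma mu_act: "\<lbrakk>g \<in> carrier G; m \<in> carrier M\<rbrakk> \<Longrightarrow> \<mu> (act X g m) = g \<otimes>\<^bsub>G\<^esub> \<mu> m \<otimes>\<^bsub>G\<^esub> inv\<^bsub>G\<^esub> g"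
  using crossed by (simp add: crossed_module_def)

lemma act_mu: "\<lbrakk>m \<in> carrier M; m' \<in> carrier M\<rbrakk> \<Longrightarrow> act X (\<mu> m) m' = m \<otimes>\<^bsub>M\<^esub> m' \<otimes>\<^bsub>M\<^esub> inv\<^bsub>M\<^esub> m"
  using crossed by (simp add: crossed_module_def)

lemma fibre: "k \<in> fibre_product X Y \<longleftrightarrow> (\<exists>m\<in>carrier M. k = (m, \<mu> m))"
  by (cases k) (auto simp: fibre_product_def)

lemma gens_iff [simp]:
  "Tensor m n \<in> gens \<longleftrightarrow> m \<in> carrier M \<and> n \<in> carrier G"
  "Brace (m, n) \<in> gens \<longleftrightarrow> m \<in> carrier M \<and> n = \<mu> m"
  by (auto simp: tensor_gens_def fibre)

text \<open>A hypothesis of \<open>eval_word_cong\<close>. The pair inside the brace of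
  \<open>brace_tensor\<close> lies in the fibre product because \<mu> is equivariant.\<close>

lemma rels_words: "rels \<subseteq> words gens \<times> words gens"
proof clarify
  fix u v assume "(u, v) \<in> rels"
  then show "u \<in> words gens \<and> v \<in> words gens"
    by cases (auto simp: fibre inv_word_def mu_act words_def A.G.m_assoc)
qed

text \<open>The six defining relations read in an arbitrary group \<open>H\<close>, with a brace
  given by its first component. They are needed for three pairs of maps: the classes in
  \<open>T\<close>, the boundary into \<open>G\<close>, and the translates by an element of
  \<open>G\<close>.\<close>

definition pairing :: "('h, 'r) monoid_scheme \<Rightarrow> ('m \<Rightarrow> 'g \<Rightarrow> 'h) \<Rightarrow> ('m \<Rightarrow> 'h) \<Rightarrow> bool" where
  "pairing H t b \<longleftrightarrow>
    (\<forall>m\<in>carrier M. \<forall>n\<in>carrier G. \<forall>n'\<in>carrier G.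
      t m (n \<otimes>\<^bsub>G\<^esub> n') = t m n \<otimes>\<^bsub>H\<^esub> t (act X n m) (n \<otimes>\<^bsub>G\<^esub> n' \<otimes>\<^bsub>G\<^esub> inv\<^bsub>G\<^esub> n)) \<and>
    (\<forall>m\<in>carrier M. \<forall>m'\<in>carrier M. \<forall>n\<in>carrier G.
      t (m \<otimes>\<^bsub>M\<^esub> m') n = t (act X (\<mu> m) m') (\<mu> m \<otimes>\<^bsub>G\<^esub> n \<otimes>\<^bsub>G\<^esub> inv\<^bsub>G\<^esub> \<mu> m) \<otimes>\<^bsub>H\<^esub> t m n) \<and>
    (\<forall>k\<in>carrier M. \<forall>m\<in>carrier M. \<forall>n\<in>carrier G.
      b k \<otimes>\<^bsub>H\<^esub> t m n \<otimes>\<^bsub>H\<^esub> inv\<^bsub>H\<^esub> b k = t (act X (\<mu> k [^]\<^bsub>G\<^esub> q) m)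
        (\<mu> k [^]\<^bsub>G\<^esub> q \<otimes>\<^bsub>G\<^esub> n \<otimes>\<^bsub>G\<^esub> inv\<^bsub>G\<^esub> (\<mu> k [^]\<^bsub>G\<^esub> q))) \<and>
    (\<forall>k\<in>carrier M. \<forall>k'\<in>carrier M.
      b (k \<otimes>\<^bsub>M\<^esub> k') = b k \<otimes>\<^bsub>H\<^esub>
        listprod H (map (\<lambda>i. t (inv\<^bsub>M\<^esub> k)
          ((\<mu> k [^]\<^bsub>G\<^esub> (1 - int q + int i) \<otimes>\<^bsub>G\<^esub> \<mu> k' \<otimes>\<^bsub>G\<^esub>
            inv\<^bsub>G\<^esub> (\<mu> k [^]\<^bsub>G\<^esub> (1 - int q + int i))) [^]\<^bsub>G\<^esub> i)) [1..<q]) \<otimes>\<^bsub>H\<^esub> b k') \<and>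
    (\<forall>k\<in>carrier M. \<forall>k'\<in>carrier M.
      b k \<otimes>\<^bsub>H\<^esub> b k' \<otimes>\<^bsub>H\<^esub> inv\<^bsub>H\<^esub> b k \<otimes>\<^bsub>H\<^esub> inv\<^bsub>H\<^esub> b k' = t (k [^]\<^bsub>M\<^esub> q) (\<mu> k' [^]\<^bsub>G\<^esub> q)) \<and>
    (\<forall>m\<in>carrier M. \<forall>n\<in>carrier G. b (m \<otimes>\<^bsub>M\<^esub> act X n (inv\<^bsub>M\<^esub> m)) = t m n [^]\<^bsub>H\<^esub> q)"

lemma pairingD:
  assumes "pairing H t b"
  shows "\<And>m n n'. \<lbrakk>m \<in> carrier M; n \<in> carrier G; n' \<in> carrier G\<rbrakk> \<Longrightarrow>
      t m (n \<otimes>\<^bsub>G\<^esub> n') = t m n \<otimes>\<^bsub>H\<^esub> t (act X n m) (n \<otimes>\<^bsub>G\<^esub> n' \<otimes>\<^bsub>G\<^esub> inv\<^bsub>G\<^esub> n)"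
    and "\<And>m m' n. \<lbrakk>m \<in> carrier M; m' \<in> carrier M; n \<in> carrier G\<rbrakk> \<Longrightarrow>
      t (m \<otimes>\<^bsub>M\<^esub> m') n = t (act X (\<mu> m) m') (\<mu> m \<otimes>\<^bsub>G\<^esub> n \<otimes>\<^bsub>G\<^esub> inv\<^bsub>G\<^esub> \<mu> m) \<otimes>\<^bsub>H\<^esub> t m n"
    and "\<And>k m n. \<lbrakk>k \<in> carrier M; m \<in> carrier M; n \<in> carrier G\<rbrakk> \<Longrightarrow>
      b k \<otimes>\<^bsub>H\<^esub> t m n \<otimes>\<^bsub>H\<^esub> inv\<^bsub>H\<^esub> b k = t (act X (\<mu> k [^]\<^bsub>G\<^esub> q) m)
        (\<mu> k [^]\<^bsub>G\<^esub> q \<otimes>\<^bsub>G\<^esub> n \<otimes>\<^bsub>G\<^esub> inv\<^bsub>G\<^esub> (\<mu> k [^]\<^bsub>G\<^esub> q))"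
    and "\<And>k k'. \<lbrakk>k \<in> carrier M; k' \<in> carrier M\<rbrakk> \<Longrightarrow>
      b (k \<otimes>\<^bsub>M\<^esub> k') = b k \<otimes>\<^bsub>H\<^esub>
        listprod H (map (\<lambda>i. t (inv\<^bsub>M\<^esub> k)
          ((\<mu> k [^]\<^bsub>G\<^esub> (1 - int q + int i) \<otimes>\<^bsub>G\<^esub> \<mu> k' \<otimes>\<^bsub>G\<^esub>
            inv\<^bsub>G\<^esub> (\<mu> k [^]\<^bsub>G\<^esub> (1 - int q + int i))) [^]\<^bsub>G\<^esub> i)) [1..<q]) \<otimes>\<^bsub>H\<^esub> b k'"
    and "\<And>k k'. \<lbrakk>k \<in> carrier M; k' \<in> carrier M\<rbrakk> \<Longrightarrow>
      b k \<otimes>\<^bsub>H\<^esub> b k' \<otimes>\<^bsub>H\<^esub> inv\<^bsub>H\<^esub> b k \<otimes>\<^bsub>H\<^esub> inv\<^bsub>H\<^esub> b k' = t (k [^]\<^bsub>M\<^esub> q) (\<mu> k' [^]\<^bsub>G\<^esub> q)"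
    and "\<And>m n. \<lbrakk>m \<in> carrier M; n \<in> carrier G\<rbrakk> \<Longrightarrow> b (m \<otimes>\<^bsub>M\<^esub> act X n (inv\<^bsub>M\<^esub> m)) = t m n [^]\<^bsub>H\<^esub> q"
  using assms unfolding pairing_def by blast+

lemma pairing_respects_rels:
  assumes H: "group H" and f: "f \<in> gens \<rightarrow> carrier H"
    and p: "pairing H (\<lambda>m n. f (Tensor m n)) (\<lambda>m. f (Brace (m, \<mu> m)))"
    and uv: "(u, v) \<in> rels"
  shows "eval_word H f u = eval_word H f v"
proof -
  interpret H: group H by fact
  have [simp]: "f x \<in> carrier H" if "x \<in> gens" for x using f that by auto
  note [simp] = inv_word_def fibre mu_act A.G.inv_mult_group
  note pD = pairingD[OF p]
  from uv show ?thesis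
  proof cases
    case (tensor_mult_right m n n')
    then show ?thesis using pD(1)[of m n n'] by simp
  next
    case (tensor_mult_left m m' n)
    then show ?thesis using pD(2)[of m m' n] by simp
  next
    case (brace_conj k m n)
    then show ?thesis using pD(3)[of "fst k" m n] by (auto simp: H.m_assoc)
  next
    case (brace_mult k k')
    then obtain a b where ab: "a \<in> carrier M" "k = (a, \<mu> a)" "b \<in> carrier M" "k' = (b, \<mu> b)" by auto
    let ?h = "\<lambda>i. Tensor (inv\<^bsub>M\<^esub> a) ((\<mu> a [^]\<^bsub>G\<^esub> (1 - int q + int i) \<otimes>\<^bsub>G\<^esub> \<mu> b \<otimes>\<^bsub>G\<^esub>
            inv\<^bsub>G\<^esub> (\<mu> a [^]\<^bsub>G\<^esub> (1 - int q + int i))) [^]\<^bsub>G\<^esub> i)"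
    have w: "map (\<lambda>i. (True, ?h i)) [1..<q] \<in> words gens"
      using ab by (auto simp: words_def)
    have c: "listprod H (map (\<lambda>i. f (?h i)) [1..<q]) \<in> carrier H"
      using ab by (intro H.listprod_closed) auto
    have "eval_word H f v = f (Brace k) \<otimes>\<^bsub>H\<^esub>
        (eval_word H f (map (\<lambda>i. (True, ?h i)) [1..<q]) \<otimes>\<^bsub>H\<^esub> f (Brace k'))"
      unfolding brace_mult using ab H.eval_word_append[OF f w, of "letter (Brace k')"]
      by (simp del: upt_Suc)
    also have "\<dots> = f (Brace k) \<otimes>\<^bsub>H\<^esub> listprod H (map (\<lambda>i. f (?h i)) [1..<q]) \<otimes>\<^bsub>H\<^esub> f (Brace k')"
      unfolding H.eval_word_letters using ab c by (simp add: H.m_assoc)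
    also have "\<dots> = f (Brace (a \<otimes>\<^bsub>M\<^esub> b, \<mu> (a \<otimes>\<^bsub>M\<^esub> b)))"
      using pD(4)[OF ab(1,3)] ab(2,4) by simp
    finally show ?thesis unfolding brace_mult using ab by (simp add: DirProd_def)
  next
    case (brace_comm k k')
    then show ?thesis using pD(5)[of "fst k" "fst k'"] by (auto simp: H.m_assoc)
  next
    case (brace_tensor m n)
    have "eval_word H f v = listprod H (replicate q (f (Tensor m n)))"
      unfolding brace_tensor concat_replicate_singleton by (simp add: eval_word_def)
    then show ?thesis
      using pD(6)[of m n] brace_tensor by (simp add: H.listprod_replicate A.G.m_assoc)
  qed
qed

lemma cls_mult: "cls (u @ v) = cls u \<otimes>\<^bsub>T\<^esub> cls v"
  by (simp add: tensor_group_def presented_group_mult)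

lemma cls_Nil: "cls [] = \<one>\<^bsub>T\<^esub>"
  by (simp add: tensor_group_def presented_group_def)

lemma carrier_T: "A \<in> carrier T \<longleftrightarrow> (\<exists>w\<in>words gens. A = cls w)"
  by (auto simp: tensor_group_def presented_group_def quotient_def)

lemma cls_closed [simp, intro]: "w \<in> words gens \<Longrightarrow> cls w \<in> carrier T"
  using carrier_T by blast

lemma cls_letter_inv: "x \<in> gens \<Longrightarrow> cls [(False, x)] = inv\<^bsub>T\<^esub> (cls (letter x))"
proof -
  assume x: "x \<in> gens"
  have "cls ([(False, x)] @ letter x) = cls []"
    using word_cong.cancel[OF x, of False] by (intro equiv_class_eq[OF equiv_word_cong]) simp
  then show ?thesis unfolding cls_mult cls_Nil using x by (intro T.inv_equality[symmetric]) auto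
qed

text \<open>Evaluation in \<open>T\<close> at the classes of letters returns the class of the word;
  through \<open>rel_eval\<close> each relation thereby becomes an equation between products in
  \<open>T\<close>.\<close>

lemma eval_cls: "w \<in> words gens \<Longrightarrow> eval_word T (\<lambda>x. cls (letter x)) w = cls w"
proof (induction w)
  case (Cons a w)
  obtain b x where a: "a = (b, x)" by (cases a)
  have "cls (a # w) = cls [a] \<otimes>\<^bsub>T\<^esub> cls w" using cls_mult[of "[a]" w] by simp
  then show ?case using Cons a by (cases b) (auto simp: cls_letter_inv)
qed (simp add: cls_Nil)

lemma rel_eval:
  assumes "(u, v) \<in> rels"
  shows "eval_word T (\<lambda>x. cls (letter x)) u = eval_word T (\<lambda>x. cls (letter x)) v"
proof -
  have "cls u = cls v" by (rule equiv_class_eq[OF equiv_word_cong word_cong.rel[OF assms]])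
  then show ?thesis using rels_words assms by (auto simp: eval_cls)
qed

lemma pairing_T: "pairing T tn br"
  unfolding pairing_def
proof (intro conjI ballI)
  note [simp] = inv_word_def fibre mu_act A.G.inv_mult_group
  fix m n n' assume c: "m \<in> carrier M" "n \<in> carrier G" "n' \<in> carrier G"
  show "tn m (n \<otimes>\<^bsub>G\<^esub> n') = tn m n \<otimes>\<^bsub>T\<^esub> tn (act X n m) (n \<otimes>\<^bsub>G\<^esub> n' \<otimes>\<^bsub>G\<^esub> inv\<^bsub>G\<^esub> n)"
    using c rel_eval[OF tensor_mult_right[of m X n Y n' q]] by simp
next
  note [simp] = inv_word_def fibre mu_act A.G.inv_mult_group
  fix m m' n assume c: "m \<in> carrier M" "m' \<in> carrier M" "n \<in> carrier G"
  show "tn (m \<otimes>\<^bsub>M\<^esub> m') n = tn (act X (\<mu> m) m') (\<mu> m \<otimes>\<^bsub>G\<^esub> n \<otimes>\<^bsub>G\<^esub> inv\<^bsub>G\<^esub> \<mu> m) \<otimes>\<^bsub>T\<^esub> tn m n"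
    using c rel_eval[OF tensor_mult_left[of m X m' n Y q]] by simp
next
  note [simp] = inv_word_def fibre mu_act A.G.inv_mult_group
  fix k m n assume c: "k \<in> carrier M" "m \<in> carrier M" "n \<in> carrier G"
  show "br k \<otimes>\<^bsub>T\<^esub> tn m n \<otimes>\<^bsub>T\<^esub> inv\<^bsub>T\<^esub> br k = tn (act X (\<mu> k [^]\<^bsub>G\<^esub> q) m)
        (\<mu> k [^]\<^bsub>G\<^esub> q \<otimes>\<^bsub>G\<^esub> n \<otimes>\<^bsub>G\<^esub> inv\<^bsub>G\<^esub> (\<mu> k [^]\<^bsub>G\<^esub> q))"
    using c rel_eval[OF brace_conj[of "(k, \<mu> k)" X Y m n q]] by (simp add: T.m_assoc)
next
  note [simp] = fibre
  fix k k' assume c: "k \<in> carrier M" "k' \<in> carrier M"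
  let ?h = "\<lambda>i. Tensor (inv\<^bsub>M\<^esub> k) ((\<mu> k [^]\<^bsub>G\<^esub> (1 - int q + int i) \<otimes>\<^bsub>G\<^esub> \<mu> k' \<otimes>\<^bsub>G\<^esub>
            inv\<^bsub>G\<^esub> (\<mu> k [^]\<^bsub>G\<^esub> (1 - int q + int i))) [^]\<^bsub>G\<^esub> i)"
  let ?f = "\<lambda>x. cls (letter x)"
  have f: "?f \<in> gens \<rightarrow> carrier T" by auto
  have w: "map (\<lambda>i. (True, ?h i)) [1..<q] \<in> words gens"
    using c by (auto simp: words_def)
  have lc: "listprod T (map (\<lambda>i. ?f (?h i)) [1..<q]) \<in> carrier T"
    using c by (intro T.listprod_closed) auto
  have "br (k \<otimes>\<^bsub>M\<^esub> k') = eval_word T ?f (letter (Brace (k, \<mu> k)) @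
      map (\<lambda>i. (True, ?h i)) [1..<q] @ letter (Brace (k', \<mu> k')))"
    using c rel_eval[OF brace_mult[of "(k, \<mu> k)" X Y "(k', \<mu> k')" q]]
    by (simp add: DirProd_def del: upt_Suc append.simps)
  also have "\<dots> = br k \<otimes>\<^bsub>T\<^esub> (eval_word T ?f (map (\<lambda>i. (True, ?h i)) [1..<q]) \<otimes>\<^bsub>T\<^esub> br k')"
    using c T.eval_word_append[OF f w, of "letter (Brace (k', \<mu> k'))"] by (simp del: upt_Suc)
  finally show "br (k \<otimes>\<^bsub>M\<^esub> k') = br k \<otimes>\<^bsub>T\<^esub> listprod T (map (\<lambda>i. ?f (?h i)) [1..<q]) \<otimes>\<^bsub>T\<^esub> br k'"
    unfolding T.eval_word_letters using c lc by (simp add: T.m_assoc)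
next
  note [simp] = inv_word_def fibre
  fix k k' assume c: "k \<in> carrier M" "k' \<in> carrier M"
  show "br k \<otimes>\<^bsub>T\<^esub> br k' \<otimes>\<^bsub>T\<^esub> inv\<^bsub>T\<^esub> br k \<otimes>\<^bsub>T\<^esub> inv\<^bsub>T\<^esub> br k' = tn (k [^]\<^bsub>M\<^esub> q) (\<mu> k' [^]\<^bsub>G\<^esub> q)"
    using c rel_eval[OF brace_comm[of "(k, \<mu> k)" X Y "(k', \<mu> k')" q]] by (simp add: T.m_assoc)
next
  fix m n assume c: "m \<in> carrier M" "n \<in> carrier G"
  let ?f = "\<lambda>x. cls (letter x)"
  have "eval_word T ?f (concat (replicate q (letter (Tensor m n)))) = listprod T (replicate q (tn m n))"
    unfolding concat_replicate_singleton by (simp add: eval_word_def)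
  then have "eval_word T ?f (letter (Brace (m \<otimes>\<^bsub>M\<^esub> act X n (inv\<^bsub>M\<^esub> m),
      \<mu> m \<otimes>\<^bsub>G\<^esub> n \<otimes>\<^bsub>G\<^esub> inv\<^bsub>G\<^esub> \<mu> m \<otimes>\<^bsub>G\<^esub> inv\<^bsub>G\<^esub> n))) = tn m n [^]\<^bsub>T\<^esub> q"
    using c rel_eval[OF brace_tensor[of m X n Y q]] by (simp add: T.listprod_replicate)
  moreover have "\<mu> m \<otimes>\<^bsub>G\<^esub> n \<otimes>\<^bsub>G\<^esub> inv\<^bsub>G\<^esub> \<mu> m \<otimes>\<^bsub>G\<^esub> inv\<^bsub>G\<^esub> n = \<mu> (m \<otimes>\<^bsub>M\<^esub> act X n (inv\<^bsub>M\<^esub> m))"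
    using c by (simp add: mu_act A.G.m_assoc)
  ultimately show "br (m \<otimes>\<^bsub>M\<^esub> act X n (inv\<^bsub>M\<^esub> m)) = tn m n [^]\<^bsub>T\<^esub> q"
    using c by simp
qed

end

lemma (in group) conj_group_hom: "g \<in> carrier G \<Longrightarrow> group_hom G G (\<lambda>x. g \<otimes> x \<otimes> inv g)"
  by (unfold_locales, rule homI) (auto simp: m_assoc inv_mult_cancel)

lemma (in group) conj_nat_pow:
  "\<lbrakk>g \<in> carrier G; a \<in> carrier G\<rbrakk> \<Longrightarrow> (g \<otimes> a \<otimes> inv g) [^] (n::nat) = g \<otimes> a [^] n \<otimes> inv g"
  using group_hom.hom_nat_pow[OF conj_group_hom] by force

section \<open>Boundary and diagonal action on classes of words\<close>

context xmod_tensor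
begin

text \<open>The only relation that is not mere cancellation is the one for {kk'}, which becomes a
  formula for (ab)^q in terms of a^q, b^q and commutators. The ith commutator is the conjugate b^i a
  b^-i framed by powers of a, and the partial products are (ab)^i b^-i, so the whole
  telescopes.\<close>

lemma pairing_bdry:
  assumes "q > 0"
  shows "pairing G (\<lambda>m n. \<mu> m \<otimes>\<^bsub>G\<^esub> n \<otimes>\<^bsub>G\<^esub> inv\<^bsub>G\<^esub> \<mu> m \<otimes>\<^bsub>G\<^esub> inv\<^bsub>G\<^esub> n) (\<lambda>m. \<mu> m [^]\<^bsub>G\<^esub> q)"
  unfolding pairing_def
proof (intro conjI ballI)
  note [simp] = mu_act A.G.m_assoc A.G.inv_mult_group A.G.inv_mult_cancel
  fix k m n assume "k \<in> carrier M" "m \<in> carrier M" "n \<in> carrier G"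
  then show "\<mu> k [^]\<^bsub>G\<^esub> q \<otimes>\<^bsub>G\<^esub> (\<mu> m \<otimes>\<^bsub>G\<^esub> n \<otimes>\<^bsub>G\<^esub> inv\<^bsub>G\<^esub> \<mu> m \<otimes>\<^bsub>G\<^esub> inv\<^bsub>G\<^esub> n) \<otimes>\<^bsub>G\<^esub> inv\<^bsub>G\<^esub> (\<mu> k [^]\<^bsub>G\<^esub> q) =
      \<mu> (act X (\<mu> k [^]\<^bsub>G\<^esub> q) m) \<otimes>\<^bsub>G\<^esub> (\<mu> k [^]\<^bsub>G\<^esub> q \<otimes>\<^bsub>G\<^esub> n \<otimes>\<^bsub>G\<^esub> inv\<^bsub>G\<^esub> (\<mu> k [^]\<^bsub>G\<^esub> q)) \<otimes>\<^bsub>G\<^esub>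
      inv\<^bsub>G\<^esub> \<mu> (act X (\<mu> k [^]\<^bsub>G\<^esub> q) m) \<otimes>\<^bsub>G\<^esub> inv\<^bsub>G\<^esub> (\<mu> k [^]\<^bsub>G\<^esub> q \<otimes>\<^bsub>G\<^esub> n \<otimes>\<^bsub>G\<^esub> inv\<^bsub>G\<^esub> (\<mu> k [^]\<^bsub>G\<^esub> q))"
    by simp
next
  fix k k' assume k: "k \<in> carrier M" "k' \<in> carrier M"
  define a where "a = \<mu> k"
  define b where "b = \<mu> k'"
  have c: "a \<in> carrier G" "b \<in> carrier G" using k by (auto simp: a_def b_def)
  define P where "P i = (a \<otimes>\<^bsub>G\<^esub> b) [^]\<^bsub>G\<^esub> i \<otimes>\<^bsub>G\<^esub> inv\<^bsub>G\<^esub> (b [^]\<^bsub>G\<^esub> i)" for i :: nat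
  define s where "s i = b [^]\<^bsub>G\<^esub> i \<otimes>\<^bsub>G\<^esub> a \<otimes>\<^bsub>G\<^esub> inv\<^bsub>G\<^esub> (b [^]\<^bsub>G\<^esub> i)" for i :: nat
  have sc: "s i \<in> carrier G" and Pc: "P i \<in> carrier G" for i using c by (auto simp: s_def P_def)
  have P1: "P 1 = a" using c by (simp add: P_def A.G.m_assoc)
  have PS: "P (Suc i) = P i \<otimes>\<^bsub>G\<^esub> s i" for i
    using c by (simp add: P_def s_def A.G.m_assoc A.G.inv_mult_cancel A.G.inv_mult_group)
  let ?j = "\<lambda>i. 1 - int q + int i"
  have tm: "\<mu> (inv\<^bsub>M\<^esub> k) \<otimes>\<^bsub>G\<^esub> y \<otimes>\<^bsub>G\<^esub> inv\<^bsub>G\<^esub> \<mu> (inv\<^bsub>M\<^esub> k) \<otimes>\<^bsub>G\<^esub> inv\<^bsub>G\<^esub> y =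
      a [^]\<^bsub>G\<^esub> (int i - int q) \<otimes>\<^bsub>G\<^esub> s i \<otimes>\<^bsub>G\<^esub> a [^]\<^bsub>G\<^esub> (int q - int i - 1)"
    if y: "y = (a [^]\<^bsub>G\<^esub> ?j i \<otimes>\<^bsub>G\<^esub> b \<otimes>\<^bsub>G\<^esub> inv\<^bsub>G\<^esub> (a [^]\<^bsub>G\<^esub> ?j i)) [^]\<^bsub>G\<^esub> i" for i y
  proof -
    define A where "A = a [^]\<^bsub>G\<^esub> ?j i"
    have A: "A \<in> carrier G" using c by (simp add: A_def)
    have "a [^]\<^bsub>G\<^esub> (int i - int q) = a [^]\<^bsub>G\<^esub> (- 1 + ?j i)" by simp
    then have e1: "a [^]\<^bsub>G\<^esub> (int i - int q) = inv\<^bsub>G\<^esub> a \<otimes>\<^bsub>G\<^esub> A"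
      unfolding A_def using c by (simp only: A.G.int_pow_mult A.G.int_pow_neg A.G.int_pow_1)
    have "a [^]\<^bsub>G\<^esub> (int q - int i - 1) = a [^]\<^bsub>G\<^esub> (- ?j i)" by (simp add: algebra_simps)
    then have e2: "a [^]\<^bsub>G\<^esub> (int q - int i - 1) = inv\<^bsub>G\<^esub> A"
      unfolding A_def using c by (simp only: A.G.int_pow_neg)
    have Aa: "A \<otimes>\<^bsub>G\<^esub> a = a \<otimes>\<^bsub>G\<^esub> A"
      unfolding A_def using c by (intro A.G.int_pow_commute) auto
    have "inv\<^bsub>G\<^esub> A \<otimes>\<^bsub>G\<^esub> (a \<otimes>\<^bsub>G\<^esub> A) = a" using A c by (simp add: A.G.inv_mult_cancel flip: Aa)
    then have Aa': "inv\<^bsub>G\<^esub> A \<otimes>\<^bsub>G\<^esub> (a \<otimes>\<^bsub>G\<^esub> (A \<otimes>\<^bsub>G\<^esub> z)) = a \<otimes>\<^bsub>G\<^esub> z" if "z \<in> carrier G" for z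
      using A c that by (metis A.G.inv_closed A.G.m_assoc A.G.m_closed)
    have "y = A \<otimes>\<^bsub>G\<^esub> b [^]\<^bsub>G\<^esub> i \<otimes>\<^bsub>G\<^esub> inv\<^bsub>G\<^esub> A"
      unfolding y A_def[symmetric] using A c by (simp add: A.G.conj_nat_pow)
    then show ?thesis
      unfolding e1 e2 s_def using A c k
      by (simp add: a_def[symmetric] A.G.m_assoc A.G.inv_mult_group Aa')
  qed
  let ?L = "listprod G (map (\<lambda>i. \<mu> (inv\<^bsub>M\<^esub> k) \<otimes>\<^bsub>G\<^esub>
      (\<mu> k [^]\<^bsub>G\<^esub> ?j i \<otimes>\<^bsub>G\<^esub> \<mu> k' \<otimes>\<^bsub>G\<^esub> inv\<^bsub>G\<^esub> (\<mu> k [^]\<^bsub>G\<^esub> ?j i)) [^]\<^bsub>G\<^esub> i \<otimes>\<^bsub>G\<^esub> inv\<^bsub>G\<^esub> \<mu> (inv\<^bsub>M\<^esub> k) \<otimes>\<^bsub>G\<^esub>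
      inv\<^bsub>G\<^esub> ((\<mu> k [^]\<^bsub>G\<^esub> ?j i \<otimes>\<^bsub>G\<^esub> \<mu> k' \<otimes>\<^bsub>G\<^esub> inv\<^bsub>G\<^esub> (\<mu> k [^]\<^bsub>G\<^esub> ?j i)) [^]\<^bsub>G\<^esub> i)) [1..<q])"
  have "?L = a [^]\<^bsub>G\<^esub> (- int q) \<otimes>\<^bsub>G\<^esub> P q \<otimes>\<^bsub>G\<^esub> a [^]\<^bsub>G\<^esub> (int q - int q)"
    unfolding a_def[symmetric] b_def[symmetric] tm[OF HOL.refl]
    by (rule A.G.listprod_telescope[OF c(1) sc Pc P1 PS]) (use assms in simp)
  show "\<mu> (k \<otimes>\<^bsub>M\<^esub> k') [^]\<^bsub>G\<^esub> q = \<mu> k [^]\<^bsub>G\<^esub> q \<otimes>\<^bsub>G\<^esub> ?L \<otimes>\<^bsub>G\<^esub> \<mu> k' [^]\<^bsub>G\<^esub> q"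
    unfolding \<open>?L = _\<close> using c k Pc[of q]
    by (simp add: P_def A.G.int_pow_neg int_pow_int A.G.m_assoc A.G.inv_mult_cancel flip: a_def b_def)
qed (auto simp: mu_act A.G.m_assoc A.G.inv_mult_group A.G.inv_mult_cancel mu.hom_nat_pow)

text \<open>The automorphism \<open>act X g\<close> of \<open>M\<close> and conjugation by g on
  \<open>G\<close> together respect \<mu> and the action, so they carry every instance of a relation
  to another instance.\<close>

lemma pairing_act:
  assumes p: "pairing H t b" and g: "g \<in> carrier G"
  shows "pairing H (\<lambda>m n. t (act X g m) (g \<otimes>\<^bsub>G\<^esub> n \<otimes>\<^bsub>G\<^esub> inv\<^bsub>G\<^esub> g)) (\<lambda>m. b (act X g m))"
proof -
  note pD = pairingD[OF p]
  define cj where "cj n = g \<otimes>\<^bsub>G\<^esub> n \<otimes>\<^bsub>G\<^esub> inv\<^bsub>G\<^esub> g" for n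
  interpret cj: group_hom G G cj unfolding cj_def using g by (rule A.G.conj_group_hom)
  have mu_g: "\<mu> (act X g m) = cj (\<mu> m)" if "m \<in> carrier M" for m
    using that g by (simp add: mu_act cj_def)
  have act_cj: "act X g (act X n m) = act X (cj n) (act X g m)" if "m \<in> carrier M" "n \<in> carrier G" for m n
    using that g by (simp add: cj_def A.ac_mult)
  have cj_cj: "cj (n \<otimes>\<^bsub>G\<^esub> n' \<otimes>\<^bsub>G\<^esub> inv\<^bsub>G\<^esub> n) = cj n \<otimes>\<^bsub>G\<^esub> cj n' \<otimes>\<^bsub>G\<^esub> inv\<^bsub>G\<^esub> cj n"
    if "n \<in> carrier G" "n' \<in> carrier G" for n n'
    using that by simp
  let ?t = "\<lambda>m n. t (act X g m) (cj n)" and ?b = "\<lambda>m. b (act X g m)"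
  show ?thesis
    unfolding pairing_def cj_def[symmetric]
  proof (intro conjI ballI)
    fix m n n' assume c: "m \<in> carrier M" "n \<in> carrier G" "n' \<in> carrier G"
    show "?t m (n \<otimes>\<^bsub>G\<^esub> n') = ?t m n \<otimes>\<^bsub>H\<^esub> ?t (act X n m) (n \<otimes>\<^bsub>G\<^esub> n' \<otimes>\<^bsub>G\<^esub> inv\<^bsub>G\<^esub> n)"
      unfolding act_cj[OF c(1,2)] cj_cj[OF c(2,3)] cj.hom_mult[OF c(2,3)]
      using c g by (intro pD(1)) auto
  next
    fix m m' n assume c: "m \<in> carrier M" "m' \<in> carrier M" "n \<in> carrier G"
    show "?t (m \<otimes>\<^bsub>M\<^esub> m') n = ?t (act X (\<mu> m) m') (\<mu> m \<otimes>\<^bsub>G\<^esub> n \<otimes>\<^bsub>G\<^esub> inv\<^bsub>G\<^esub> \<mu> m) \<otimes>\<^bsub>H\<^esub> ?t m n"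
      unfolding act_cj[OF c(2) mu.hom_closed[OF c(1)]] cj_cj[OF mu.hom_closed[OF c(1)] c(3)]
        A.ac_distrib[OF g c(1,2)] mu_g[OF c(1), symmetric]
      using c g by (intro pD(2)) auto
  next
    fix k m n assume c: "k \<in> carrier M" "m \<in> carrier M" "n \<in> carrier G"
    have e: "\<mu> k [^]\<^bsub>G\<^esub> q \<in> carrier G" "cj (\<mu> k [^]\<^bsub>G\<^esub> q) = \<mu> (act X g k) [^]\<^bsub>G\<^esub> q"
      using c by (simp_all add: mu_g cj.hom_nat_pow)
    show "?b k \<otimes>\<^bsub>H\<^esub> ?t m n \<otimes>\<^bsub>H\<^esub> inv\<^bsub>H\<^esub> ?b k = ?t (act X (\<mu> k [^]\<^bsub>G\<^esub> q) m)
        (\<mu> k [^]\<^bsub>G\<^esub> q \<otimes>\<^bsub>G\<^esub> n \<otimes>\<^bsub>G\<^esub> inv\<^bsub>G\<^esub> (\<mu> k [^]\<^bsub>G\<^esub> q))"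
      unfolding act_cj[OF c(2) e(1)] cj_cj[OF e(1) c(3)] e(2)
      using c g by (intro pD(3)) auto
  next
    fix k k' assume c: "k \<in> carrier M" "k' \<in> carrier M"
    have "cj ((\<mu> k [^]\<^bsub>G\<^esub> j \<otimes>\<^bsub>G\<^esub> \<mu> k' \<otimes>\<^bsub>G\<^esub> inv\<^bsub>G\<^esub> (\<mu> k [^]\<^bsub>G\<^esub> j)) [^]\<^bsub>G\<^esub> i) =
        (\<mu> (act X g k) [^]\<^bsub>G\<^esub> j \<otimes>\<^bsub>G\<^esub> \<mu> (act X g k') \<otimes>\<^bsub>G\<^esub> inv\<^bsub>G\<^esub> (\<mu> (act X g k) [^]\<^bsub>G\<^esub> j)) [^]\<^bsub>G\<^esub> i"
      for j :: int and i :: nat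
      using c by (simp add: mu_g cj.hom_nat_pow cj.hom_int_pow)
    then show "?b (k \<otimes>\<^bsub>M\<^esub> k') = ?b k \<otimes>\<^bsub>H\<^esub>
        listprod H (map (\<lambda>i. ?t (inv\<^bsub>M\<^esub> k)
          ((\<mu> k [^]\<^bsub>G\<^esub> (1 - int q + int i) \<otimes>\<^bsub>G\<^esub> \<mu> k' \<otimes>\<^bsub>G\<^esub>
            inv\<^bsub>G\<^esub> (\<mu> k [^]\<^bsub>G\<^esub> (1 - int q + int i))) [^]\<^bsub>G\<^esub> i)) [1..<q]) \<otimes>\<^bsub>H\<^esub> ?b k'"
      using pD(4)[OF A.ac_closed[OF g c(1)] A.ac_closed[OF g c(2)]] c g
      by (simp only: A.ac_distrib A.ac_inv)
  next
    fix k k' assume c: "k \<in> carrier M" "k' \<in> carrier M"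
    show "?b k \<otimes>\<^bsub>H\<^esub> ?b k' \<otimes>\<^bsub>H\<^esub> inv\<^bsub>H\<^esub> ?b k \<otimes>\<^bsub>H\<^esub> inv\<^bsub>H\<^esub> ?b k' = ?t (k [^]\<^bsub>M\<^esub> q) (\<mu> k' [^]\<^bsub>G\<^esub> q)"
      using pD(5)[OF A.ac_closed[OF g c(1)] A.ac_closed[OF g c(2)]] c g
      by (simp only: A.ac_pow cj.hom_nat_pow mu_g mu.hom_closed)
  next
    fix m n assume c: "m \<in> carrier M" "n \<in> carrier G"
    have "act X g (m \<otimes>\<^bsub>M\<^esub> act X n (inv\<^bsub>M\<^esub> m)) =
        act X g m \<otimes>\<^bsub>M\<^esub> act X (cj n) (inv\<^bsub>M\<^esub> (act X g m))"
      using c g by (simp only: A.ac_distrib A.ac_closed A.T.inv_closed act_cj A.ac_inv cj.hom_closed)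
    then show "?b (m \<otimes>\<^bsub>M\<^esub> act X n (inv\<^bsub>M\<^esub> m)) = ?t m n [^]\<^bsub>H\<^esub> q"
      using pD(6)[of "act X g m" "cj n"] c g by simp
  qed
qed

text \<open>Bridges two forms of a translated brace: acting on a letter yields g \<mu>(m) g^-1 as
  second component, which agrees with \<mu>(^g m) only for m in the carrier.\<close>

lemma pairing_cong:
  assumes p: "pairing H t b" and eq: "\<And>m. m \<in> carrier M \<Longrightarrow> b' m = b m"
  shows "pairing H t b'"
  unfolding pairing_def
proof (intro conjI ballI, goal_cases)
  case (1 m n n')
  then show ?case by (rule pairingD(1)[OF p])
next
  case (2 m m' n)
  then show ?case by (rule pairingD(2)[OF p])
next
  case (3 k m n)
  then show ?case using pairingD(3)[OF p 3] by (simp only: eq)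
next
  case (4 k k')
  then show ?case using pairingD(4)[OF p 4] by (simp only: eq A.T.m_closed)
next
  case (5 k k')
  then show ?case using pairingD(5)[OF p 5] by (simp only: eq)
next
  case (6 m n)
  then show ?case using pairingD(6)[OF p 6] by (simp only: eq A.T.m_closed A.T.inv_closed A.ac_closed)
qed

lemma word_bdry_eval: "word_bdry q X Y w = eval_word G (gen_bdry q X Y) w"
  by (induction w) auto

lemma gen_bdry_closed: "gen_bdry q X Y \<in> gens \<rightarrow> carrier G"
  by (auto simp: tensor_gens_def fibre)

text \<open>Well-definedness of \<beta>: the relations hold for the values of
  \<open>gen_bdry\<close>, so the image under \<open>the_elem\<close> is a singleton.\<close>

lemma tensor_bdry_cls:
  assumes "q > 0" "w \<in> words gens"
  shows "tensor_bdry q X Y (cls w) = eval_word G (gen_bdry q X Y) w"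
proof -
  have "eval_word G (gen_bdry q X Y) u = eval_word G (gen_bdry q X Y) v" if "(u, v) \<in> rels" for u v
    by (rule pairing_respects_rels[OF A.G.group_axioms gen_bdry_closed _ that])
      (use pairing_bdry[OF assms(1)] in \<open>simp add: A.G.m_assoc\<close>)
  then have "eval_word G (gen_bdry q X Y) v = eval_word G (gen_bdry q X Y) w" if "v \<in> cls w" for v
    using A.G.eval_word_cong[OF rels_words gen_bdry_closed, of w v] that assms by auto
  then have "word_bdry q X Y ` cls w = (\<lambda>_. eval_word G (gen_bdry q X Y) w) ` cls w"
    unfolding word_bdry_eval by (intro image_cong[OF HOL.refl])
  also have "\<dots> = {eval_word G (gen_bdry q X Y) w}"
    by (rule image_constant[of w]) (simp add: word_cong.refl)
  finally show ?thesis by (simp add: tensor_bdry_def)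
qed

lemma tensor_bdry_hom: "q > 0 \<Longrightarrow> tensor_bdry q X Y \<in> hom T G"
  by (rule homI)
    (use gen_bdry_closed A.G.eval_word_append[OF gen_bdry_closed] in
      \<open>auto simp: carrier_T tensor_bdry_cls simp flip: cls_mult\<close>)

abbreviation act_gen :: "'g \<Rightarrow> ('m, 'g) tgen \<Rightarrow> ('m, 'g) tgen" where
  "act_gen g \<equiv> map_tgen (act X g) (\<lambda>n. g \<otimes>\<^bsub>G\<^esub> n \<otimes>\<^bsub>G\<^esub> inv\<^bsub>G\<^esub> g)"

abbreviation act_word :: "'g \<Rightarrow> ('m, 'g) tgen word \<Rightarrow> ('m, 'g) tgen word" where
  "act_word g \<equiv> map (\<lambda>(b, x). (b, act_gen g x))"

lemma act_gen_closed: "\<lbrakk>g \<in> carrier G; x \<in> gens\<rbrakk> \<Longrightarrow> act_gen g x \<in> gens"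
  by (cases x) (auto simp: mu_act)

lemma act_word_closed: "\<lbrakk>g \<in> carrier G; w \<in> words gens\<rbrakk> \<Longrightarrow> act_word g w \<in> words gens"
  by (induction w) (auto simp: act_gen_closed)

lemma cls_act_word:
  assumes "g \<in> carrier G" "w \<in> words gens"
  shows "cls (act_word g w) = eval_word T (\<lambda>x. cls (letter (act_gen g x))) w"
proof -
  have "eval_word T (\<lambda>x. cls (letter x)) (act_word g w) =
      eval_word T (\<lambda>x. cls (letter (act_gen g x))) w"
    by (induction w) auto
  then show ?thesis using eval_cls[OF act_word_closed[OF assms]] by simp
qed

text \<open>Well-definedness of the diagonal action: all words of a class have translates in one and
  the same class, so the union in \<open>tensor_act\<close> collapses.\<close>

lemma tensor_act_cls:
  assumes g: "g \<in> carrier G" and w: "w \<in> words gens"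
  shows "tensor_act q X Y g (cls w) = cls (act_word g w)"
proof -
  let ?f = "\<lambda>x. cls (letter (act_gen g x))"
  have f: "?f \<in> gens \<rightarrow> carrier T" using act_gen_closed[OF g] by auto
  have "eval_word T ?f u = eval_word T ?f v" if "(u, v) \<in> rels" for u v
  proof (rule pairing_respects_rels[OF T.group_axioms f _ that])
    have "pairing T (\<lambda>m n. ?f (Tensor m n)) (\<lambda>m. br (act X g m))"
      using pairing_act[OF pairing_T g] by simp
    then show "pairing T (\<lambda>m n. ?f (Tensor m n)) (\<lambda>m. ?f (Brace (m, \<mu> m)))"
      by (rule pairing_cong) (use g in \<open>simp add: mu_act\<close>)
  qed
  then have "cls (act_word g v) = cls (act_word g w)" if "v \<in> cls w" for v
    using T.eval_word_cong[OF rels_words f, of w v] that assms by (auto simp: cls_act_word)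
  moreover have "w \<in> cls w" by (simp add: word_cong.refl)
  ultimately have "(\<Union>v\<in>cls w. cls (act_word g v)) = cls (act_word g w)" by blast
  moreover have "act Y g = (\<lambda>n. g \<otimes>\<^bsub>G\<^esub> n \<otimes>\<^bsub>G\<^esub> inv\<^bsub>G\<^esub> g)" by (simp add: id_xmod_def)
  ultimately show ?thesis by (simp add: tensor_act_def)
qed

lemma generate_T: "generate T ({tn m n | m n. m \<in> carrier M \<and> n \<in> carrier G} \<union> br ` carrier M) = carrier T"
  (is "generate T ?S = _")
proof
  have Sc: "?S \<subseteq> carrier T" by auto
  show "generate T ?S \<subseteq> carrier T" using Sc by (rule T.generate_incl)
  have letter: "cls (letter x) \<in> ?S" if "x \<in> gens" for x
    using that by (auto simp: tensor_gens_def fibre)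
  have gen: "cls w \<in> generate T ?S" if "w \<in> words gens" for w
    using that
  proof (induction w)
    case Nil
    show ?case unfolding cls_Nil by (rule generate.one)
  next
    case (Cons a w)
    obtain b x where a: "a = (b, x)" by (cases a)
    then have x: "x \<in> gens" "w \<in> words gens" using Cons by auto
    have "cls [a] \<in> generate T ?S"
    proof (cases b)
      case True
      then show ?thesis using generate.incl[OF letter[OF x(1)]] by (simp only: a)
    next
      case False
      then show ?thesis using generate.inv[OF letter[OF x(1)]] by (simp only: a cls_letter_inv[OF x(1)])
    qed
    then have "cls [a] \<otimes>\<^bsub>T\<^esub> cls w \<in> generate T ?S" using Cons.IH[OF x(2)] by (rule generate.eng)
    then show ?case using cls_mult[of "[a]" w] by (simp only: append.simps)
  qed
  show "carrier T \<subseteq> generate T ?S"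
  proof
    fix t assume "t \<in> carrier T"
    then obtain w where "w \<in> words gens" "t = cls w" unfolding carrier_T ..
    with gen show "t \<in> generate T ?S" by (simp only:)
  qed
qed

text \<open>Makes the abstract calculus available for the presented group. Once the action on
  letters is known, the tensors with translated entries in the relations can be restated as
  translates of tensors.\<close>

lemma tensor_calculus:
  assumes q: "odd q"
  shows "tensor_calculus T M G (tensor_act q X Y) (act X) \<mu> tn br (tensor_bdry q X Y) q"
proof -
  have q0: "q > 0" using q by (cases q) auto
  note pD = pairingD[OF pairing_T]
  have tn_act: "tensor_act q X Y g (tn m n) = tn (act X g m) (g \<otimes>\<^bsub>G\<^esub> n \<otimes>\<^bsub>G\<^esub> inv\<^bsub>G\<^esub> g)"
    if "g \<in> carrier G" "m \<in> carrier M" "n \<in> carrier G" for g m n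
    using that by (simp add: tensor_act_cls)
  have br_act: "tensor_act q X Y g (br m) = br (act X g m)"
    if "g \<in> carrier G" "m \<in> carrier M" for g m
    using that by (simp add: tensor_act_cls mu_act)
  have act: "aut_action T G (tensor_act q X Y)"
  proof (unfold_locales)
    show "tensor_act q X Y g \<in> hom T T" if "g \<in> carrier G" for g
      by (rule homI)
        (use that in \<open>auto simp: carrier_T tensor_act_cls act_word_closed simp flip: cls_mult\<close>)
    have one: "act_word \<one>\<^bsub>G\<^esub> w = w" if "w \<in> words gens" for w
      using that
    proof (induction w)
      case (Cons a w)
      then show ?case by (cases a; cases "snd a") (auto simp: A.ac_one)
    qed simp
    then show "tensor_act q X Y \<one>\<^bsub>G\<^esub> t = t" if "t \<in> carrier T" for t
      using that by (auto simp: carrier_T tensor_act_cls)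
    have comp: "act_word (g \<otimes>\<^bsub>G\<^esub> h) w = act_word g (act_word h w)"
      if "g \<in> carrier G" "h \<in> carrier G" "w \<in> words gens" for g h w
      using that(3)
    proof (induction w)
      case (Cons a w)
      then show ?case using that
        by (cases a; cases "snd a") (auto simp: A.ac_mult A.G.m_assoc A.G.inv_mult_group)
    qed simp
    show "tensor_act q X Y (g \<otimes>\<^bsub>G\<^esub> h) t = tensor_act q X Y g (tensor_act q X Y h t)"
      if gh: "g \<in> carrier G" "h \<in> carrier G" and t: "t \<in> carrier T" for g h t
    proof -
      obtain w where w: "w \<in> words gens" "t = cls w" using t carrier_T by blast
      show ?thesis
        unfolding w(2) tensor_act_cls[OF A.G.m_closed[OF gh] w(1)] tensor_act_cls[OF gh(2) w(1)]
          tensor_act_cls[OF gh(1) act_word_closed[OF gh(2) w(1)]] comp[OF gh w(1)] ..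
    qed
  qed
  show ?thesis
    unfolding tensor_calculus_def tensor_calculus_axioms_def
  proof (intro conjI allI impI act)
    show "aut_action M G (act X)" by (rule A.aut_action_axioms)
    show "generate T ({tn m n | m n. m \<in> carrier M \<and> n \<in> carrier G} \<union> br ` carrier M) = carrier T"
      by (rule generate_T)
    show "tensor_bdry q X Y \<in> hom T G" by (rule tensor_bdry_hom[OF q0])
    show "br (k \<otimes>\<^bsub>M\<^esub> k') = br k \<otimes>\<^bsub>T\<^esub>
        listprod T (map (\<lambda>i. tn (inv\<^bsub>M\<^esub> k)
          ((\<mu> k [^]\<^bsub>G\<^esub> (1 - int q + int i) \<otimes>\<^bsub>G\<^esub> \<mu> k' \<otimes>\<^bsub>G\<^esub>
            inv\<^bsub>G\<^esub> (\<mu> k [^]\<^bsub>G\<^esub> (1 - int q + int i))) [^]\<^bsub>G\<^esub> i)) [1..<q]) \<otimes>\<^bsub>T\<^esub> br k'"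
      if "k \<in> carrier M" "k' \<in> carrier M" for k k'
      using that by (rule pD(4))
    show "br (m \<otimes>\<^bsub>M\<^esub> act X n (inv\<^bsub>M\<^esub> m)) = tn m n [^]\<^bsub>T\<^esub> q"
      if "m \<in> carrier M" "n \<in> carrier G" for m n
      using that by (rule pD(6))
    show "tn m (n \<otimes>\<^bsub>G\<^esub> n') = tn m n \<otimes>\<^bsub>T\<^esub> tensor_act q X Y n (tn m n')"
      if "m \<in> carrier M" "n \<in> carrier G" "n' \<in> carrier G" for m n n'
      using pD(1)[OF that] that by (simp only: tn_act)
    show "tn (m \<otimes>\<^bsub>M\<^esub> m') n = tensor_act q X Y (\<mu> m) (tn m' n) \<otimes>\<^bsub>T\<^esub> tn m n"
      if "m \<in> carrier M" "m' \<in> carrier M" "n \<in> carrier G" for m m' n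
      using pD(2)[OF that] that by (simp only: tn_act mu.hom_closed)
    show "br k \<otimes>\<^bsub>T\<^esub> tn m n \<otimes>\<^bsub>T\<^esub> inv\<^bsub>T\<^esub> br k = tensor_act q X Y (\<mu> k [^]\<^bsub>G\<^esub> q) (tn m n)"
      if "k \<in> carrier M" "m \<in> carrier M" "n \<in> carrier G" for k m n
      using pD(3)[OF that] that by (simp only: tn_act mu.hom_closed A.G.nat_pow_closed)
    show "br k \<otimes>\<^bsub>T\<^esub> br k' \<otimes>\<^bsub>T\<^esub> inv\<^bsub>T\<^esub> br k \<otimes>\<^bsub>T\<^esub> inv\<^bsub>T\<^esub> br k' = tn (k [^]\<^bsub>M\<^esub> q) (\<mu> k' [^]\<^bsub>G\<^esub> q)"
      if "k \<in> carrier M" "k' \<in> carrier M" for k k'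
      using that by (rule pD(5))
  qed (use q q0 in \<open>auto simp: mu.homh mu_act act_mu tn_act br_act tensor_bdry_cls A.G.m_assoc\<close>)
qed

end


section \<open>Powerful crossed modules\<close>

definition powerful_xmod :: "nat \<Rightarrow> ('m, 'g) xmod \<Rightarrow> bool" where
  "powerful_xmod p X \<longleftrightarrow> crossed_module X \<and> finite_p_group p (src X) \<and>
    (\<forall>g\<in>carrier (tgt X). \<forall>m\<in>carrier (src X).
      act X g m \<otimes>\<^bsub>src X\<^esub> inv\<^bsub>src X\<^esub> m \<in> pow_subgroup p (src X))"

lemma powerful_xmod_tensor:
  assumes p: "prime p" "odd p" and X: "powerful_xmod p X" and G: "finite_p_group p (tgt X)"
  shows "powerful_xmod p (tensor_xmod p X (id_xmod (tgt X)))"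
proof -
  interpret xmod_tensor p X
    using X by unfold_locales (simp add: powerful_xmod_def)
  interpret C: tensor_calculus T M G "tensor_act p X Y" "act X" \<mu> tn br "tensor_bdry p X Y" p
    by (rule tensor_calculus[OF p(2)])
  have M: "finite_p_group p M" using X by (simp add: powerful_xmod_def)
  have pw: "act X g m \<otimes>\<^bsub>M\<^esub> inv\<^bsub>M\<^esub> m \<in> pow_subgroup p M" if "g \<in> carrier G" "m \<in> carrier M" for g m
    using X that by (simp add: powerful_xmod_def)
  show ?thesis
    using C.finite_p_group_tensor[OF p(1) M G] C.powerful_action_tensor[OF p(1) M G pw]
    by (auto simp: powerful_xmod_def crossed_module_def tensor_xmod_def C.bd_hom C.A.ac_iso C.A.ac_one
        C.A.ac_mult C.bd_ac C.peiffer T.group_axioms A.G.group_axioms)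
qed

lemma src_tgt_relabel_xmod [simp]:
  "src (relabel_xmod f X) = image_group f (src X)" "tgt (relabel_xmod f X) = tgt X"
  by (simp_all add: relabel_xmod_def Let_def)

lemma src_tgt_tensor_xmod [simp]:
  "src (tensor_xmod q X Y) = tensor_group q X Y" "tgt (tensor_xmod q X Y) = src Y"
  by (simp_all add: tensor_xmod_def)

text \<open>Transport of structure; \<open>f\<close> is a homomorphism onto the image group, so
  \<open>hom_pow_subgroup\<close> carries the power condition over.\<close>

lemma powerful_xmod_relabel:
  assumes X: "powerful_xmod p X" and f: "inj_on f (carrier (src X))"
  shows "powerful_xmod p (relabel_xmod f X)"
proof -
  interpret xmod_tensor p X
    using X by unfold_locales (simp add: powerful_xmod_def)
  let ?N = "image_group f M" and ?f = "inv_into (carrier M) f"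
  interpret N: group ?N by (rule A.T.inj_imp_image_group_is_group[OF f])
  have ff: "?f (f m) = m" if "m \<in> carrier M" for m using f that by simp
  have mult: "f a \<otimes>\<^bsub>?N\<^esub> f b = f (a \<otimes>\<^bsub>M\<^esub> b)" if "a \<in> carrier M" "b \<in> carrier M" for a b
    using that by (simp add: image_group_def ff)
  have car: "carrier ?N = f ` carrier M" by (rule image_group_carrier)
  interpret F: group_hom M ?N f
    by unfold_locales (auto intro!: homI simp: mult car)
  have inv: "inv\<^bsub>?N\<^esub> (f m) = f (inv\<^bsub>M\<^esub> m)" if "m \<in> carrier M" for m
    using that by simp
  let ?a = "\<lambda>g y. f (act X g (?f y))"
  have "aut_action ?N G ?a"
    by unfold_locales (auto intro!: homI simp: car ff A.ac_distrib A.ac_one A.ac_mult simp flip: F.hom_mult)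
  then interpret NA: aut_action ?N G ?a .
  have r: "src (relabel_xmod f X) = ?N" "tgt (relabel_xmod f X) = G"
    "bdry (relabel_xmod f X) = (\<lambda>y. \<mu> (?f y))" "act (relabel_xmod f X) = ?a"
    by (simp_all add: relabel_xmod_def Let_def)
  have "crossed_module (relabel_xmod f X)"
    unfolding crossed_module_def r
  proof (intro conjI ballI)
    show "(\<lambda>y. \<mu> (?f y)) \<in> hom ?N G"
      by (rule homI) (auto simp: car ff simp flip: F.hom_mult)
  next
    fix m m' assume "m \<in> carrier ?N" "m' \<in> carrier ?N"
    then obtain a b where "a \<in> carrier M" "m = f a" "b \<in> carrier M" "m' = f b" unfolding car by blast
    then show "f (act X (\<mu> (?f m)) (?f m')) = m \<otimes>\<^bsub>?N\<^esub> m' \<otimes>\<^bsub>?N\<^esub> inv\<^bsub>?N\<^esub> m"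
      by (simp add: ff act_mu)
  next
    fix g assume "g \<in> carrier G"
    then show "?a g \<in> iso ?N ?N" by (rule NA.ac_iso)
  next
    fix m assume "m \<in> carrier ?N"
    then show "?a \<one>\<^bsub>G\<^esub> m = m" by (rule NA.ac_one)
  next
    fix g h m assume "g \<in> carrier G" "h \<in> carrier G" "m \<in> carrier ?N"
    then show "?a (g \<otimes>\<^bsub>G\<^esub> h) m = ?a g (?a h m)" by (rule NA.ac_mult)
  next
    fix g m assume "g \<in> carrier G" "m \<in> carrier ?N"
    then show "\<mu> (?f (?a g m)) = g \<otimes>\<^bsub>G\<^esub> \<mu> (?f m) \<otimes>\<^bsub>G\<^esub> inv\<^bsub>G\<^esub> g"
      by (auto simp: car ff mu_act)
  qed (simp_all add: N.group_axioms A.G.group_axioms)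
  moreover have "finite_p_group p ?N"
    using X f N.group_axioms
    by (auto simp: powerful_xmod_def finite_p_group_def order_def car card_image)
  moreover have "?a g m \<otimes>\<^bsub>?N\<^esub> inv\<^bsub>?N\<^esub> m \<in> pow_subgroup p ?N" if gm: "g \<in> carrier G" "m \<in> carrier ?N" for g m
  proof -
    obtain x where x: "x \<in> carrier M" "m = f x" using gm(2) unfolding car by blast
    have "f (act X g x \<otimes>\<^bsub>M\<^esub> inv\<^bsub>M\<^esub> x) \<in> pow_subgroup p ?N"
      using X x gm(1) by (intro F.hom_pow_subgroup) (simp add: powerful_xmod_def)
    then show ?thesis using x gm(1) by (simp add: ff)
  qed
  ultimately show ?thesis by (simp add: powerful_xmod_def r)
qed

text \<open>\<open>M\<close> acts on itself by conjugation through \<mu>, so the commutator of a and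
  b is the displacement of b under \<mu>(a).\<close>

lemma powerful_xmod_imp_powerful:
  assumes X: "powerful_xmod p X"
  shows "powerful_p_group p (src X)"
proof -
  interpret xmod_tensor p X
    using X by unfold_locales (simp add: powerful_xmod_def)
  have "a \<otimes>\<^bsub>M\<^esub> b \<otimes>\<^bsub>M\<^esub> inv\<^bsub>M\<^esub> a \<otimes>\<^bsub>M\<^esub> inv\<^bsub>M\<^esub> b \<in> pow_subgroup p M"
    if "a \<in> carrier M" "b \<in> carrier M" for a b
  proof -
    have "act X (\<mu> a) b \<otimes>\<^bsub>M\<^esub> inv\<^bsub>M\<^esub> b \<in> pow_subgroup p M"
      using X that by (simp add: powerful_xmod_def)
    then show ?thesis by (simp only: act_mu[OF that])
  qed
  then have "derived M (carrier M) \<subseteq> pow_subgroup p M"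
    unfolding derived_def by (intro A.T.generate_subgroup_incl A.T.subgroup_pow_subgroup) auto
  then show ?thesis using X by (simp add: powerful_p_group_def powerful_xmod_def)
qed

lemma powerful_xmod_id:
  assumes "powerful_p_group p G"
  shows "powerful_xmod p (id_xmod G)"
proof -
  have "group G" using assms by (simp add: powerful_p_group_def finite_p_group_def)
  moreover have "g \<otimes>\<^bsub>G\<^esub> m \<otimes>\<^bsub>G\<^esub> inv\<^bsub>G\<^esub> g \<otimes>\<^bsub>G\<^esub> inv\<^bsub>G\<^esub> m \<in> derived G (carrier G)"
    if "g \<in> carrier G" "m \<in> carrier G" for g m
    unfolding derived_def using that by (intro generate.incl) auto
  ultimately show ?thesis
    using assms by (auto simp: powerful_xmod_def powerful_p_group_def crossed_module_id_xmod)
qed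

text \<open>Relabelling \<open>id_xmod G\<close> along \<open>Base\<close> leaves the target alone,
  but its source is \<open>base_group G\<close>, and only the source is read off.\<close>

lemma powerful_base_group:
  assumes "powerful_p_group p G"
  shows "powerful_p_group p (base_group G)"
  using powerful_xmod_imp_powerful[OF powerful_xmod_relabel[OF powerful_xmod_id[OF assms], of Base]]
  by (simp add: base_group_def inj_on_def)

lemma powerful_relabel_tensor:
  assumes "prime p" "odd p" "powerful_xmod p X" "finite_p_group p (tgt X)"
  shows "powerful_xmod p (relabel_xmod label (tensor_xmod p X (id_xmod (tgt X))))"
  by (rule powerful_xmod_relabel[OF powerful_xmod_tensor[OF assms]])
    (simp add: inj_on_label)

text \<open>The target is carried through the induction because the step tensors with the identity
  of \<open>base_group G\<close>, while \<open>powerful_relabel_tensor\<close> speaks of the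
  identity of the current target.\<close>

lemma powerful_nfold_xmod:
  assumes p: "prime p" "odd p" and G: "powerful_p_group p G"
  shows "powerful_xmod p (nfold_xmod p G n) \<and> tgt (nfold_xmod p G n) = base_group G"
proof -
  let ?B = "base_group G"
  let ?F = "\<lambda>X. relabel_xmod label (tensor_xmod p X (id_xmod ?B))"
  have B: "powerful_p_group p ?B" by (rule powerful_base_group[OF G])
  have "powerful_xmod p ((?F ^^ k) (id_xmod ?B)) \<and> tgt ((?F ^^ k) (id_xmod ?B)) = ?B" for k
  proof (induction k)
    case 0
    then show ?case using powerful_xmod_id[OF B] by simp
  next
    case (Suc k)
    then show ?case
      using powerful_relabel_tensor[OF p, of "(?F ^^ k) (id_xmod ?B)"] B
      by (simp add: powerful_p_group_def)
  qed
  then show ?thesis by (simp add: nfold_xmod_def)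
qed

text \<open>Each stage restarts from the identity crossed module of the previous group, so
  powerfulness of that group is all that has to be passed on.\<close>

lemma powerful_iterated_tensor:
  assumes p: "prime p" "odd p" and G: "powerful_p_group p G"
  shows "powerful_p_group p (iterated_tensor p G n)"
proof -
  have step: "powerful_p_group p (image_group label (tensor_group p (id_xmod H) (id_xmod H)))"
    if "powerful_p_group p H" for H :: "'a univ monoid"
    using powerful_xmod_imp_powerful[OF powerful_relabel_tensor[OF p powerful_xmod_id[OF that]]] that
    by (simp add: powerful_p_group_def)
  have "powerful_p_group p (((\<lambda>H. image_group label (tensor_group p (id_xmod H) (id_xmod H))) ^^ k)
      (base_group G))" for k
    by (induction k) (use powerful_base_group[OF G] step in auto)
  then show ?thesis by (simp add: iterated_tensor_def)
qed

theorem mainTheorem6: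
  fixes p :: nat and G :: "'a monoid"
  assumes "prime p" and "odd p"
    and "powerful_p_group p G"
  shows "\<forall>n\<ge>1. powerful_p_group p (nfold_tensor p G (n + 1)) \<and>
               powerful_p_group p (iterated_tensor p G (n + 1))"
  using powerful_nfold_xmod[OF assms] powerful_xmod_imp_powerful powerful_iterated_tensor[OF assms]
  by (auto simp: nfold_tensor_def)

end
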